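(* Let $k\ge 1$ be an integer and let $\zeta$ be a primitive root of unity of order $4k$. Define, for $|q|<1$, \[ S_3(1;q):=\sum_{n=0}^{\infty}\frac{(q;q^2)_{n}(-1)^nq^{n^2}}{(-1;q^2)_{n+1}(-q^2;q^2)_{n}}. \] Then, as $q$ approaches $\zeta$ radially within the unit disk, \[ \lim_{q\rightarrow \zeta} \Big ( S_3(1;q)-\frac{J_{1,2}^2}{\overline{J}_{0,1}}\Big )=-2\sum_{n=0}^{k-1}\frac{\zeta^{2n+2}(-\zeta^2;\zeta^2)_n^2}{(\zeta;\zeta^2)_{n+1}}. \]
   Context: Throughout, $q$ is a complex number with $0<|q|<1$. For $x\in\mathbb{C}$ and $n\ge 0$, $(x;q)_n:=\prod_{i=0}^{n-1}(1-xq^i)$ (also used with any other base, e.g. $(x;\zeta^2)_n=\prod_{i=0}^{n-1}(1-x\zeta^{2i})$) and $(x;q)_\infty:=\prod_{i\ge 0}(1-xq^i)$. The theta function is $j(x;q):=(x;q)_\infty(q/x;q)_\infty(q;q)_\infty$. For integers $a$ and $m>0$: $J_{a,m}:=j(q^a;q^m)$ and $\overline{J}_{a,m}:=j(-q^a;q^m)$. "$q$ approaches $\zeta$ radially" means $q=r\zeta$ with $r\to 1^-$. *)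

theory Defs
  imports "HOL-Analysis.Analysis"
begin

definition primitive_root_of_unity :: "nat \<Rightarrow> complex \<Rightarrow> bool" where
  "primitive_root_of_unity n z \<longleftrightarrow>
     n > 0 \<and> z ^ n = 1 \<and> (\<forall>m. 0 < m \<and> m < n \<longrightarrow> z ^ m \<noteq> 1)"

text \<open>The base \<open>b\<close> of the finite symbol \<open>(x;b)\<^sub>n\<close> is arbitrary; the infinite symbol
  is meaningful for a base with \<open>norm b < 1\<close>.\<close>

definition qpoch :: "complex \<Rightarrow> complex \<Rightarrow> nat \<Rightarrow> complex" where
  "qpoch x b n = (\<Prod>i<n. 1 - x * b ^ i)"

definition qpoch_inf :: "complex \<Rightarrow> complex \<Rightarrow> complex" where
  "qpoch_inf x b = (\<Prod>i. 1 - x * b ^ i)"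

definition theta_j :: "complex \<Rightarrow> complex \<Rightarrow> complex" where
  "theta_j x q = qpoch_inf x q * qpoch_inf (q / x) q * qpoch_inf q q"

definition theta_J :: "int \<Rightarrow> nat \<Rightarrow> complex \<Rightarrow> complex" where
  "theta_J a m q = theta_j (q powi a) (q ^ m)"

definition theta_J_bar :: "int \<Rightarrow> nat \<Rightarrow> complex \<Rightarrow> complex" where
  "theta_J_bar a m q = theta_j (- (q powi a)) (q ^ m)"

text \<open>The value at \<open>x = 1\<close> of the two-variable series \<open>S\<^sub>3(x;q)\<close>.\<close>

definition S3_one :: "complex \<Rightarrow> complex" where
  "S3_one q = (\<Sum>n. qpoch q (q\<^sup>2) n * (-1) ^ n * q ^ (n\<^sup>2) /
                    (qpoch (-1) (q\<^sup>2) (n + 1) * qpoch (- (q\<^sup>2)) (q\<^sup>2) n))"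

end

theory Submission
  imports Defs
begin

text \<open>
  Put \<open>p = q\<^sup>2\<close>. The summand of \<open>S\<^sub>3(1;q)\<close> makes sense for all integers \<open>n\<close>, and the terms with
  negative index add up to \<open>2 C(q)\<close> with
  \<open>C(q) = \<Sum>\<^sub>n q\<^sup>2\<^sup>n\<^sup>+\<^sup>2 (-p;p)\<^sub>n\<^sup>2 / (q;p)\<^sub>n\<^sub>+\<^sub>1\<close>, which terminates at \<open>q = \<zeta>\<close> and gives the claimed limit.
  Two applications of the q-binomial theorem turn the bilateral series into a multiple of
  \<open>\<Sum>\<^sub>n (q;p)\<^sub>n (-q)\<^sup>n / (1 + p\<^sup>n)\<close> (a case of Bailey's transformation of \<open>\<^sub>2\<psi>\<^sub>2\<close>). Writing
  \<open>(q;p)\<^sub>n / (1 + p\<^sup>n)\<close> as a constant multiple of \<open>1 / (1 + p\<^sup>n)\<close> plus a telescoping series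
  reduces it to cases of Ramanujan's \<open>\<^sub>1\<psi>\<^sub>1\<close> sum; the result is
  \<open>S\<^sub>3(1;q) + 2 C(q) = J\<^sub>1\<^sub>,\<^sub>2\<^sup>2 / Jbar\<^sub>0\<^sub>,\<^sub>1 - 2 (-p;p)\<^sub>\<infinity>\<^sup>2 / (q;p)\<^sub>\<infinity> \<Sum>\<^sub>m\<^sub>\<ge>\<^sub>1 (-q)\<^sup>m / (-q;p)\<^sub>m\<close>.
  As \<open>q = r \<zeta>\<close> tends to \<open>\<zeta>\<close>, the products \<open>(\<plusminus>q;p)\<^sub>n\<close> stay bounded away from \<open>0\<close>, while for \<open>n \<ge> k\<close> the
  product \<open>(-p;p)\<^sub>n\<close> contains the factor \<open>1 - r\<^sup>2\<^sup>k\<close> and is \<open>O(1 - r)\<close>, uniformly in \<open>n\<close>. Hence the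
  last term and the tail of \<open>C(q)\<close> are both \<open>O(1 - r)\<close>.
\<close>

section \<open>The q-binomial theorem\<close>

lemma convergent_prod_qpoch:
  fixes x b :: complex
  assumes "norm b < 1"
  shows "convergent_prod (\<lambda>i. 1 - x * b ^ i)"
proof -
  have "summable (\<lambda>i. norm x * norm b ^ i)"
    using assms by (intro summable_mult summable_geometric) auto
  hence "summable (\<lambda>i. norm ((1 - x * b ^ i) - 1))"
    by (simp add: norm_mult norm_power)
  thus ?thesis
    by (intro abs_convergent_prod_imp_convergent_prod summable_imp_abs_convergent_prod)
qed

lemma qpoch_tendsto_qpoch_inf:
  assumes "norm b < 1"
  shows "(\<lambda>n. qpoch x b n) \<longlonglongrightarrow> qpoch_inf x b"
proof -
  have "(\<lambda>n. \<Prod>i\<le>n. 1 - x * b ^ i) \<longlonglongrightarrow> (\<Prod>i. 1 - x * b ^ i)"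
    by (rule convergent_prod_LIMSEQ[OF convergent_prod_qpoch[OF assms]])
  hence "(\<lambda>n. qpoch x b (Suc n)) \<longlonglongrightarrow> qpoch_inf x b"
    by (simp add: qpoch_def qpoch_inf_def lessThan_Suc_atMost)
  thus ?thesis by (rule LIMSEQ_imp_Suc)
qed

lemma qpoch_0 [simp]: "qpoch x b 0 = 1"
  by (simp add: qpoch_def)

lemma qpoch_Suc: "qpoch x b (Suc n) = qpoch x b n * (1 - x * b ^ n)"
  by (simp add: qpoch_def)

lemma qpoch_add: "qpoch x b (m + n) = qpoch x b m * qpoch (x * b ^ m) b n"
  by (induction n) (simp_all add: qpoch_Suc power_add mult_ac)

lemma qpoch_Suc_head: "qpoch x b (Suc n) = (1 - x) * qpoch (x * b) b n"
  using qpoch_add[of x b 1 n] by (simp add: qpoch_Suc)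

lemma qpoch_inf_split:
  assumes "norm b < 1"
  shows "qpoch_inf x b = qpoch x b n * qpoch_inf (x * b ^ n) b"
proof -
  have "(\<lambda>m. qpoch x b (m + n)) \<longlonglongrightarrow> qpoch_inf x b"
    by (intro LIMSEQ_ignore_initial_segment qpoch_tendsto_qpoch_inf assms)
  moreover have "(\<lambda>m. qpoch x b n * qpoch (x * b ^ n) b m) \<longlonglongrightarrow> qpoch x b n * qpoch_inf (x * b ^ n) b"
    by (intro tendsto_mult tendsto_const qpoch_tendsto_qpoch_inf assms)
  ultimately show ?thesis
    by (simp add: qpoch_add add.commute[of _ n] LIMSEQ_unique)
qed

lemma qpoch_inf_head:
  assumes "norm b < 1"
  shows "qpoch_inf x b = (1 - x) * qpoch_inf (x * b) b"
  using qpoch_inf_split[OF assms, of x 1] by (simp add: qpoch_Suc)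

lemma qpoch_inf_nonzero:
  assumes "norm b < 1" "\<And>i. x * b ^ i \<noteq> 1"
  shows "qpoch_inf x b \<noteq> 0"
  unfolding qpoch_inf_def
  by (rule prodinf_nonzero[OF convergent_prod_qpoch[OF assms(1)]]) (use assms(2) in auto)

lemma qpoch_inf_nonzero_norm_less:
  assumes "norm b < 1" "norm x < 1"
  shows "qpoch_inf x b \<noteq> 0"
proof (rule qpoch_inf_nonzero[OF assms(1)])
  fix i
  have "norm (x * b ^ i) \<le> norm x * 1"
    unfolding norm_mult norm_power using assms by (intro mult_left_mono power_le_one) auto
  thus "x * b ^ i \<noteq> 1" using assms by auto
qed

lemma qpoch_nonzero:
  assumes "\<And>i. i < n \<Longrightarrow> x * b ^ i \<noteq> 1"
  shows "qpoch x b n \<noteq> 0"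
  using assms by (auto simp: qpoch_def)

lemma qpoch_nonzero_norm_less:
  assumes "norm b < 1" "norm x < 1"
  shows "qpoch x b n \<noteq> 0"
proof (rule qpoch_nonzero)
  fix i
  have "norm (x * b ^ i) \<le> norm x * 1"
    unfolding norm_mult norm_power using assms by (intro mult_left_mono power_le_one) auto
  thus "x * b ^ i \<noteq> 1" using assms by auto
qed

text \<open>Once x b^N lies in the unit disc, no later factor vanishes. From there on the tail is
  the quotient of the infinite product by its partial product, and both tend to the same nonzero
  limit.\<close>

lemma qpoch_inf_tail_tendsto:
  assumes "norm b < 1"
  shows "(\<lambda>n. qpoch_inf (x * b ^ n) b) \<longlonglongrightarrow> 1"
proof -
  have "(\<lambda>n. x * b ^ n) \<longlonglongrightarrow> x * 0"
    by (intro tendsto_intros LIMSEQ_power_zero assms)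
  hence "eventually (\<lambda>n. dist (x * b ^ n) 0 < 1) sequentially"
    by (intro tendstoD) auto
  then obtain N where N: "norm (x * b ^ N) < 1"
    by (auto simp: eventually_sequentially)
  define y where "y = x * b ^ N"
  have y: "norm y < 1" using N by (simp add: y_def)
  have nz: "qpoch y b n \<noteq> 0" for n
    by (rule qpoch_nonzero_norm_less[OF assms y])
  have nzi: "qpoch_inf y b \<noteq> 0"
    by (rule qpoch_inf_nonzero_norm_less[OF assms y])
  have "(\<lambda>n. qpoch_inf y b / qpoch y b n) \<longlonglongrightarrow> qpoch_inf y b / qpoch_inf y b"
    by (intro tendsto_divide tendsto_const qpoch_tendsto_qpoch_inf assms nzi)
  moreover have "qpoch_inf y b / qpoch y b n = qpoch_inf (x * b ^ (n + N)) b" for n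
    using qpoch_inf_split[OF assms, of y n] nz[of n]
    by (simp add: y_def power_add mult_ac)
  ultimately have "(\<lambda>n. qpoch_inf (x * b ^ (n + N)) b) \<longlonglongrightarrow> 1"
    using nzi by simp
  thus ?thesis by (rule LIMSEQ_offset)
qed

text \<open>The ratio enters as a multiplier and not as a quotient of terms, so vanishing terms
  cause no trouble.\<close>

lemma summable_ratio_tendsto:
  fixes f :: "nat \<Rightarrow> complex"
  assumes "\<And>n. f (Suc n) = g n * f n" and "g \<longlonglongrightarrow> L" and "norm L < 1"
  shows "summable (\<lambda>n. norm (f n))"
proof -
  obtain c where c: "norm L < c" "c < 1"
    using dense[OF assms(3)] by auto
  have "(\<lambda>n. norm (g n)) \<longlonglongrightarrow> norm L"
    by (intro tendsto_norm assms)
  hence "eventually (\<lambda>n. norm (g n) < c) sequentially"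
    using c by (simp add: order_tendsto_iff)
  then obtain N where N: "\<And>n. n \<ge> N \<Longrightarrow> norm (g n) < c"
    by (auto simp: eventually_sequentially)
  show ?thesis
  proof (rule summable_ratio_test[of c N])
    show "c < 1" by fact
    fix n assume "n \<ge> N"
    show "norm (norm (f (Suc n))) \<le> c * norm (norm (f n))"
      using N[OF \<open>n \<ge> N\<close>] by (simp add: assms(1) norm_mult mult_right_mono)
  qed
qed

lemma power_norm_neq_1:
  fixes b :: "'a :: real_normed_div_algebra"
  assumes "norm b < 1" "n > 0"
  shows "b ^ n \<noteq> 1"
proof
  assume "b ^ n = 1"
  hence "norm b ^ n = 1" by (metis norm_one norm_power)
  moreover have "norm b ^ n < 1" using assms by (simp add: power_less_one_iff)
  ultimately show False by simp
qed

lemma summable_norm_qbinomial: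
  assumes "norm b < 1" "norm z < 1"
  shows "summable (\<lambda>k. norm (qpoch a b k / qpoch b b k * z ^ k))"
proof (rule summable_ratio_tendsto)
  show "qpoch a b (Suc k) / qpoch b b (Suc k) * z ^ Suc k =
     ((1 - a * b ^ k) / (1 - b * b ^ k) * z) * (qpoch a b k / qpoch b b k * z ^ k)" for k
    by (simp add: qpoch_Suc mult_ac)
  show "(\<lambda>k. (1 - a * b ^ k) / (1 - b * b ^ k) * z) \<longlonglongrightarrow> (1 - a * 0) / (1 - b * 0) * z"
    by (intro tendsto_intros LIMSEQ_power_zero assms) auto
  show "norm ((1 - a * 0) / (1 - b * 0) * z) < 1" using assms by simp
qed

text \<open>Iterating \<open>(1 - z) F(z) = (1 - a z) F(b z)\<close> and using the continuity of the
  power series \<open>F\<close> at \<open>0\<close>.\<close>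
theorem q_binomial:
  assumes b: "norm b < 1" and z: "norm z < 1"
  shows "(\<lambda>k. qpoch a b k / qpoch b b k * z ^ k) sums (qpoch_inf (a * z) b / qpoch_inf z b)"
proof -
  define c where "c = (\<lambda>k. qpoch a b k / qpoch b b k)"
  define F where "F = (\<lambda>w. \<Sum>k. c k * w ^ k)"
  have summ: "summable (\<lambda>k. c k * w ^ k)" if "norm w < 1" for w
    using summable_norm_cancel[OF summable_norm_qbinomial[OF b that, of a]] by (simp add: c_def)
  have F: "(\<lambda>k. c k * w ^ k) sums F w" if "norm w < 1" for w
    unfolding F_def by (rule summable_sums[OF summ[OF that]])
  have c_rec: "c (Suc k) * (1 - b ^ Suc k) = c k * (1 - a * b ^ k)" for k
    using power_norm_neq_1[OF b, of "Suc k"] by (simp add: c_def qpoch_Suc)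
  have bw: "norm (b * w) < 1" if "norm w < 1" for w
    using mult_strict_mono'[of "norm b" 1 "norm w" 1] b that by (simp add: norm_mult)
  have F_rec: "(1 - w) * F w = (1 - a * w) * F (b * w)" if w: "norm w < 1" for w
  proof -
    have "(\<lambda>k. c k * w ^ k - c k * (b * w) ^ k) sums (F w - F (b * w))"
      by (intro sums_diff F bw w)
    hence "(\<lambda>k. c (Suc k) * w ^ Suc k - c (Suc k) * (b * w) ^ Suc k) sums (F w - F (b * w))"
      using sums_Suc_iff[of "\<lambda>k. c k * w ^ k - c k * (b * w) ^ k" "F w - F (b * w)"] by simp
    moreover have "(\<lambda>k. w * (c k * w ^ k) - (a * w) * (c k * (b * w) ^ k)) sums (w * F w - (a * w) * F (b * w))"
      by (intro sums_diff sums_mult F bw w)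
    moreover have "c (Suc k) * w ^ Suc k - c (Suc k) * (b * w) ^ Suc k
        = w * (c k * w ^ k) - (a * w) * (c k * (b * w) ^ k)" for k
    proof -
      have "c (Suc k) * w ^ Suc k - c (Suc k) * (b * w) ^ Suc k = (c (Suc k) * (1 - b ^ Suc k)) * w ^ Suc k"
        by (simp add: power_mult_distrib algebra_simps del: power_Suc)
      also have "\<dots> = (c k * (1 - a * b ^ k)) * w ^ Suc k"
        by (simp only: c_rec)
      also have "\<dots> = w * (c k * w ^ k) - (a * w) * (c k * (b * w) ^ k)"
        by (simp add: power_mult_distrib algebra_simps)
      finally show ?thesis .
    qed
    ultimately have "F w - F (b * w) = w * F w - (a * w) * F (b * w)"
      by (simp add: sums_unique2)
    thus ?thesis by (simp add: algebra_simps)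
  qed
  have zb: "norm (z * b ^ n) < 1" for n
  proof -
    have "norm z * norm b ^ n \<le> norm z * 1"
      using b by (intro mult_left_mono power_le_one) auto
    thus ?thesis using z by (simp add: norm_mult norm_power)
  qed
  have iter: "qpoch z b n * F z = qpoch (a * z) b n * F (z * b ^ n)" for n
  proof (induction n)
    case (Suc n)
    have "qpoch z b (Suc n) * F z = (qpoch (a * z) b n * F (z * b ^ n)) * (1 - z * b ^ n)"
      using Suc by (simp add: qpoch_Suc)
    also have "\<dots> = qpoch (a * z) b n * ((1 - z * b ^ n) * F (z * b ^ n))" by simp
    also have "\<dots> = qpoch (a * z) b (Suc n) * F (z * b ^ Suc n)"
      by (subst F_rec[OF zb]) (simp add: qpoch_Suc mult_ac)
    finally show ?case .
  qed simp
  \<comment> \<open>Convergence at the nonzero point K makes 0 interior to the disc of convergence,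
    which gives continuity there.\<close>
  obtain K where K: "norm z < K" "K < 1" using dense[OF z] by auto
  have "isCont F 0"
    unfolding F_def
    by (rule isCont_powser[OF summ[of "of_real K"]]) (use K norm_ge_zero[of z] in \<open>auto simp del: norm_ge_zero\<close>)
  moreover have "(\<lambda>n. z * b ^ n) \<longlonglongrightarrow> 0"
    using tendsto_mult[OF tendsto_const LIMSEQ_power_zero[OF b], of z] by simp
  ultimately have "(\<lambda>n. F (z * b ^ n)) \<longlonglongrightarrow> F 0"
    by (rule isCont_tendsto_compose)
  moreover have "F 0 = 1"
    using powser_zero[of c] by (simp add: F_def c_def)
  ultimately have "(\<lambda>n. qpoch (a * z) b n * F (z * b ^ n)) \<longlonglongrightarrow> qpoch_inf (a * z) b * 1"
    by (intro tendsto_mult qpoch_tendsto_qpoch_inf b) auto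
  moreover have "(\<lambda>n. qpoch z b n * F z) \<longlonglongrightarrow> qpoch_inf z b * F z"
    by (intro tendsto_mult qpoch_tendsto_qpoch_inf b tendsto_const)
  ultimately have "qpoch_inf z b * F z = qpoch_inf (a * z) b"
    by (simp add: iter LIMSEQ_unique)
  hence "F z = qpoch_inf (a * z) b / qpoch_inf z b"
    using qpoch_inf_nonzero_norm_less[OF b z] by (simp add: field_simps)
  thus ?thesis using F[OF z] by (simp add: c_def)
qed

section \<open>Bilateral series\<close>

lemma sums_imp_has_sum:
  fixes f :: "nat \<Rightarrow> complex"
  assumes "f sums s" "summable (\<lambda>n. norm (f n))"
  shows "(f has_sum s) UNIV"
  using norm_summable_imp_has_sum[OF assms(2,1)] .

lemma summable_on_int_norm:
  fixes f :: "int \<Rightarrow> complex"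
  assumes "summable (\<lambda>n. norm (f (int n)))" "summable (\<lambda>n. norm (f (- int n)))"
  shows "(\<lambda>n. norm (f n)) summable_on UNIV"
proof -
  have "(\<lambda>n. norm (f n)) summable_on range int"
    using assms(1) by (subst summable_on_reindex) (auto simp: o_def summable_on_UNIV_nonneg_real_iff)
  moreover have "(\<lambda>n. norm (f n)) summable_on range (\<lambda>n. - int n)"
    using assms(2) by (subst summable_on_reindex) (auto simp: inj_on_def o_def summable_on_UNIV_nonneg_real_iff)
  ultimately have "(\<lambda>n. norm (f n)) summable_on (range int \<union> range (\<lambda>n. - int n))"
    by (rule summable_on_union)
  also have "range int \<union> range (\<lambda>n. - int n) = UNIV"
  proof -
    have "m \<in> range int \<union> range (\<lambda>n. - int n)" for m
      by (cases m rule: int_cases2) auto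
    thus ?thesis by blast
  qed
  finally show ?thesis .
qed

lemma summable_on_int_ratio:
  fixes f :: "int \<Rightarrow> complex"
  assumes "\<And>n. f (int n + 1) = g n * f (int n)" "g \<longlonglongrightarrow> L" "norm L < 1"
    and "\<And>n. f (- int n - 1) = h n * f (- int n)" "h \<longlonglongrightarrow> M" "norm M < 1"
  shows "(\<lambda>n. norm (f n)) summable_on UNIV"
proof (rule summable_on_int_norm)
  show "summable (\<lambda>n. norm (f (int n)))"
    by (rule summable_ratio_tendsto[OF _ assms(2,3)]) (use assms(1) in \<open>simp add: add.commute\<close>)
  show "summable (\<lambda>n. norm (f (- int n)))"
    by (rule summable_ratio_tendsto[OF _ assms(5,6)]) (use assms(4) in \<open>simp add: minus_diff_commute\<close>)
qed

text \<open>Fubini for an absolutely convergent double series, summed once along rows (m fixed) and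
  once along diagonals (m - k = n fixed). This is the mechanism behind every transformation
  below.\<close>

lemma has_sum_shear:
  fixes F :: "int \<Rightarrow> nat \<Rightarrow> complex"
  assumes "(\<lambda>(m, k). norm (F m k)) summable_on UNIV \<times> UNIV"
    and "\<And>m. ((\<lambda>k. F m k) has_sum r m) UNIV"
    and "\<And>n. ((\<lambda>k. F (n + int k) k) has_sum s n) UNIV"
  shows "\<exists>S. (r has_sum S) UNIV \<and> (s has_sum S) UNIV"
proof -
  have "(\<lambda>x. norm ((\<lambda>(m, k). F m k) x)) summable_on UNIV \<times> UNIV"
    using assms(1) by (simp add: case_prod_unfold)
  hence "(\<lambda>(m, k). F m k) summable_on UNIV \<times> UNIV"
    by (rule abs_summable_summable)
  then obtain S where S: "((\<lambda>(m, k). F m k) has_sum S) (UNIV \<times> UNIV)"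
    by (auto simp: summable_on_def)
  have "((\<lambda>(n, k). F (n + int k) k) has_sum S) (UNIV \<times> UNIV)"
    using S by (subst has_sum_reindex_bij_witness[of _ "\<lambda>(m, k). (m - int k, k)" "\<lambda>(n, k). (n + int k, k)"]) auto
  hence "(s has_sum S) UNIV"
    by (rule has_sum_SigmaD) (use assms(3) in auto)
  moreover have "(r has_sum S) UNIV"
    by (rule has_sum_SigmaD[OF S]) (use assms(2) in auto)
  ultimately show ?thesis by blast
qed

lemma summable_on_times_norm:
  fixes u :: "'a \<Rightarrow> complex" and v :: "'b \<Rightarrow> complex"
  assumes "(\<lambda>x. norm (u x)) summable_on UNIV" "(\<lambda>y. norm (v y)) summable_on UNIV"
  shows "(\<lambda>(x, y). norm (u x * v y)) summable_on UNIV \<times> UNIV"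
proof -
  have "(\<lambda>(x, y). norm (u x) * norm (v y)) summable_on UNIV \<times> UNIV"
    using assms by (intro summable_on_SigmaI[where g = "\<lambda>x. norm (u x) * (\<Sum>\<^sub>\<infinity>y. norm (v y))"])
      (auto intro!: has_sum_cmult_right has_sum_infsum summable_on_cmult_left)
  thus ?thesis by (simp add: norm_mult)
qed

text \<open>The shear applied to u m * v k: the row sums factor, so the diagonal sums add up to a
  product of two series.\<close>

lemma has_sum_convolution:
  fixes u :: "int \<Rightarrow> complex" and v :: "nat \<Rightarrow> complex"
  assumes u: "(\<lambda>m. norm (u m)) summable_on UNIV" and v: "summable (\<lambda>k. norm (v k))"
    and s: "\<And>n. ((\<lambda>k. u (n + int k) * v k) has_sum s n) UNIV"
  shows "(s has_sum ((\<Sum>\<^sub>\<infinity>m. u m) * (\<Sum>k. v k))) UNIV"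
proof -
  have v': "(\<lambda>k. norm (v k)) summable_on UNIV"
    using v by (simp add: summable_on_UNIV_nonneg_real_iff)
  have V: "(v has_sum (\<Sum>k. v k)) UNIV"
    using norm_summable_imp_has_sum[OF v summable_sums[OF summable_norm_cancel[OF v]]] .
  have 1: "((\<lambda>k. u m * v k) has_sum u m * (\<Sum>k. v k)) UNIV" for m
    by (rule has_sum_cmult_right[OF V])
  have "\<exists>S. ((\<lambda>m. u m * (\<Sum>k. v k)) has_sum S) UNIV \<and> (s has_sum S) UNIV"
    by (rule has_sum_shear[OF summable_on_times_norm[OF u v'] 1 s])
  moreover have "((\<lambda>m. u m * (\<Sum>k. v k)) has_sum ((\<Sum>\<^sub>\<infinity>m. u m) * (\<Sum>k. v k))) UNIV"
    by (rule has_sum_cmult_left[OF has_sum_infsum[OF abs_summable_summable[OF u]]])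
  ultimately show ?thesis by (metis has_sum_unique)
qed

text \<open>For every integer \<open>n\<close>, \<open>(a;p)\<^sub>n = (a;p)\<^sub>\<infinity> / (a p\<^sup>n;p)\<^sub>\<infinity>\<close> is \<open>(a;p)\<^sub>\<infinity>\<close> times the following.\<close>
definition rqpoch :: "complex \<Rightarrow> complex \<Rightarrow> int \<Rightarrow> complex" where
  "rqpoch a p n = inverse (qpoch_inf (a * p powi n) p)"

section \<open>q-Pochhammer symbols with integer index\<close>

locale q_base =
  fixes p :: complex
  assumes norm_p: "norm p < 1" and p_nz: "p \<noteq> 0"
begin

lemma qpoch_inf_step: "qpoch_inf (a * p powi n) p = (1 - a * p powi n) * qpoch_inf (a * p powi (n + 1)) p"
  using qpoch_inf_head[OF norm_p, of "a * p powi n"] p_nz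
  by (simp add: power_int_add mult_ac)

lemma powi_shift: "a * p powi n * p ^ k = a * p powi (n + int k)"
  using p_nz by (simp add: power_int_add)

lemma qpoch_inf_powi_nonzero:
  assumes "\<And>n. a * p powi n \<noteq> 1"
  shows "qpoch_inf (a * p powi n) p \<noteq> 0"
  by (rule qpoch_inf_nonzero[OF norm_p]) (simp add: powi_shift assms)

lemma rqpoch_add:
  assumes "\<And>n. a * p powi n \<noteq> 1"
  shows "rqpoch a p (n + int k) = qpoch (a * p powi n) p k * rqpoch a p n"
proof -
  have "qpoch (a * p powi n) p k \<noteq> 0"
    by (rule qpoch_nonzero) (simp add: powi_shift assms)
  thus ?thesis
    using qpoch_inf_split[OF norm_p, of "a * p powi n" k]
    by (simp add: rqpoch_def powi_shift)
qed

lemma rqpoch_Suc: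
  assumes "\<And>n. a * p powi n \<noteq> 1"
  shows "rqpoch a p (n + 1) = (1 - a * p powi n) * rqpoch a p n"
  using rqpoch_add[OF assms, of n 1] by (simp add: qpoch_Suc)

lemma rqpoch_pred:
  assumes "\<And>n. a * p powi n \<noteq> 1"
  shows "rqpoch a p (n - 1) = inverse (1 - a * p powi (n - 1)) * rqpoch a p n"
proof -
  have "1 - a * p powi (n - 1) \<noteq> 0" using assms[of "n - 1"] by simp
  thus ?thesis using rqpoch_Suc[OF assms, of "n - 1"] by simp
qed

text \<open>Multiplying numerator and denominator by p^(n+1) gives p^(n+1) / (p^(n+1) - a). This is
  the ratio of consecutive \<open>rqpoch\<close> values towards minus infinity.\<close>

lemma inverse_one_minus_powi_tendsto:
  assumes "a \<noteq> 0"
  shows "(\<lambda>n. inverse (1 - a * p powi (- int n - 1))) \<longlonglongrightarrow> 0"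
proof -
  have "(\<lambda>n. p ^ Suc n / (p ^ Suc n - a)) \<longlonglongrightarrow> 0 / (0 - a)"
    using assms LIMSEQ_power_zero[OF norm_p, THEN LIMSEQ_Suc] by (intro tendsto_intros) auto
  moreover have "inverse (1 - a * p powi (- int n - 1)) = p ^ Suc n / (p ^ Suc n - a)" for n
  proof -
    have "p powi (- int n - 1) = inverse (p ^ Suc n)"
      using power_int_minus[of p "int (Suc n)"] power_int_of_nat[of p "Suc n"]
      by (simp add: minus_diff_commute del: power_int_of_nat)
    hence "1 - a * p powi (- int n - 1) = (p ^ Suc n - a) / p ^ Suc n"
      using p_nz by (simp add: field_simps)
    thus ?thesis by simp
  qed
  ultimately show ?thesis by simp
qed

text \<open>The term ratio tends to z on the right and to 0 on the left, so the bilateral series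
  converges in the whole punctured unit disc.\<close>

lemma summable_rqpoch:
  assumes a: "\<And>n. a * p powi n \<noteq> 1" "a \<noteq> 0" and z: "z \<noteq> 0" "norm z < 1"
  shows "(\<lambda>n. norm (z powi n * rqpoch a p n)) summable_on UNIV"
proof (rule summable_on_int_ratio)
  show "z powi (int n + 1) * rqpoch a p (int n + 1)
      = (z * (1 - a * p ^ n)) * (z powi int n * rqpoch a p (int n))" for n
    unfolding rqpoch_Suc[OF a(1), of "int n"] using z by (simp add: power_int_add)
  show "(\<lambda>n. z * (1 - a * p ^ n)) \<longlonglongrightarrow> z * (1 - a * 0)"
    by (intro tendsto_intros LIMSEQ_power_zero norm_p)
  show "norm (z * (1 - a * 0)) < 1" using z by simp
  show "z powi (- int n - 1) * rqpoch a p (- int n - 1)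
      = (inverse z * inverse (1 - a * p powi (- int n - 1))) * (z powi - int n * rqpoch a p (- int n))" for n
    unfolding rqpoch_pred[OF a(1), of "- int n"] using z by (simp add: power_int_diff divide_inverse)
  show "(\<lambda>n. inverse z * inverse (1 - a * p powi (- int n - 1))) \<longlonglongrightarrow> inverse z * 0"
    by (intro tendsto_mult tendsto_const inverse_one_minus_powi_tendsto a)
qed auto

lemma rqpoch_tendsto: "(\<lambda>k. rqpoch a p (n + int k)) \<longlonglongrightarrow> 1"
proof -
  have "(\<lambda>k. inverse (qpoch_inf (a * p powi n * p ^ k) p)) \<longlonglongrightarrow> inverse 1"
    by (rule tendsto_inverse[OF qpoch_inf_tail_tendsto[OF norm_p]]) simp
  thus ?thesis unfolding rqpoch_def powi_shift by simp
qed

lemma rqpoch_bounded: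
  assumes a: "\<And>n. a * p powi n \<noteq> 1" "a \<noteq> 0"
  obtains C where "C > 0" "\<And>n. norm (rqpoch a p n) \<le> C"
proof -
  have "Bseq (\<lambda>k. rqpoch a p (0 + int k))"
    by (rule convergent_imp_Bseq[OF convergentI[OF rqpoch_tendsto]])
  then obtain C where C: "C > 0" "\<forall>k. norm (rqpoch a p (0 + int k)) \<le> C"
    by (rule BseqE)
  \<comment> \<open>The weight (1/2)^n is at least 1 at nonpositive n, so a bound on the summable
    family f bounds \<open>rqpoch\<close> there.\<close>
  define f where "f = (\<lambda>n. (1/2) powi n * rqpoch a p n)"
  have "(\<lambda>n. norm (f n)) summable_on UNIV"
    unfolding f_def by (rule summable_rqpoch[OF a]) auto
  then obtain D where D: "\<And>n. norm (f n) \<le> D"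
    using finite_sum_le_infsum[of "\<lambda>n. norm (f n)" UNIV "{n}" for n] by auto
  have "norm (rqpoch a p n) \<le> max C D" for n
  proof (cases n rule: int_cases2)
    case (nonneg k)
    have "norm (rqpoch a p n) \<le> C" using spec[OF C(2), of k] nonneg by simp
    thus ?thesis by simp
  next
    case (nonpos k)
    have "(1 / 2 :: complex) powi n = 2 ^ k"
      by (simp add: nonpos power_int_minus power_one_over)
    hence "norm (f n) = 2 ^ k * norm (rqpoch a p n)"
      by (simp add: f_def norm_mult norm_power)
    moreover have "1 * norm (rqpoch a p n) \<le> 2 ^ k * norm (rqpoch a p n)"
      by (rule mult_right_mono) auto
    ultimately show ?thesis using D[of n] by simp
  qed
  thus ?thesis using that[of "max C D"] C(1) by simp
qed

text \<open>The q-binomial theorem with numerator parameter a p^n and argument b/a. It writes (b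
  p^n;p)_\<infinity> / (a p^n;p)_\<infinity> as a superposition of shifts of
  \<open>rqpoch\<close>.\<close>

lemma rqpoch_expansion:
  assumes a: "\<And>n. a * p powi n \<noteq> 1" "a \<noteq> 0" and ba: "norm (b / a) < 1"
  shows "((\<lambda>k. rqpoch a p (n + int k) * ((b / a) ^ k / qpoch p p k)) has_sum
           (qpoch_inf (b * p powi n) p / qpoch_inf (b / a) p * rqpoch a p n)) UNIV"
proof -
  have "((\<lambda>k. qpoch (a * p powi n) p k / qpoch p p k * (b / a) ^ k) has_sum
         (qpoch_inf (a * p powi n * (b / a)) p / qpoch_inf (b / a) p)) UNIV"
    by (intro sums_imp_has_sum q_binomial summable_norm_qbinomial norm_p ba)
  from has_sum_cmult_left[OF this, of "rqpoch a p n"] show ?thesis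
    using a(2) by (simp add: rqpoch_add[OF a(1)] mult_ac)
qed

section \<open>Ramanujan's bilateral sum and division by a linear factor\<close>

lemma summable_power_over_qpoch:
  assumes "norm z < 1"
  shows "summable (\<lambda>k. norm (z ^ k / qpoch p p k))"
  using summable_norm_qbinomial[OF norm_p assms, of 0] by (simp add: qpoch_def)

lemma sums_power_over_qpoch:
  assumes "norm z < 1"
  shows "(\<lambda>k. z ^ k / qpoch p p k) sums (1 / qpoch_inf z p)"
  using q_binomial[OF norm_p assms, of 0] by (simp add: qpoch_def qpoch_inf_def)

text \<open>Multiplied by (a;p)_\<infinity>, this is Ramanujan's 1psi1 series with lower parameter
  0.\<close>

definition bilat :: "complex \<Rightarrow> complex \<Rightarrow> complex" where
  "bilat a z = (\<Sum>\<^sub>\<infinity>n. z powi n * rqpoch a p n)"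

text \<open>Reduces a general lower parameter b to 0. After expanding by
  \<open>rqpoch_expansion\<close> and putting m = n + k, the weight z^n becomes z^m z^(-k), and the
  double sum factors into \<open>bilat a z\<close> and a series in b/(a z).\<close>

lemma has_sum_bilat_ratio:
  assumes a: "\<And>n. a * p powi n \<noteq> 1" "a \<noteq> 0" and z: "z \<noteq> 0" "norm z < 1"
    and ba: "norm (b / a) < 1" "norm (b / (a * z)) < 1"
  shows "((\<lambda>n. z powi n * qpoch_inf (b * p powi n) p * rqpoch a p n) has_sum
           (qpoch_inf (b / a) p / qpoch_inf (b / (a * z)) p * bilat a z)) UNIV"
proof -
  define v where "v = (\<lambda>k. (b / (a * z)) ^ k / qpoch p p k)"
  have V: "(\<Sum>k. v k) = 1 / qpoch_inf (b / (a * z)) p"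
    using sums_power_over_qpoch[OF ba(2)] by (simp add: v_def sums_iff)
  have nz: "qpoch_inf (b / a) p \<noteq> 0"
    by (rule qpoch_inf_nonzero_norm_less[OF norm_p ba(1)])
  have "((\<lambda>n. z powi n * (qpoch_inf (b * p powi n) p / qpoch_inf (b / a) p * rqpoch a p n)) has_sum
      (\<Sum>\<^sub>\<infinity>m. z powi m * rqpoch a p m) * (\<Sum>k. v k)) UNIV"
  proof (rule has_sum_convolution)
    show "summable (\<lambda>k. norm (v k))"
      unfolding v_def by (rule summable_power_over_qpoch[OF ba(2)])
    show "((\<lambda>k. z powi (n + int k) * rqpoch a p (n + int k) * v k) has_sum
      z powi n * (qpoch_inf (b * p powi n) p / qpoch_inf (b / a) p * rqpoch a p n)) UNIV" for n
    proof -
      have "z powi n * (rqpoch a p (n + int k) * ((b / a) ^ k / qpoch p p k))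
          = z powi (n + int k) * rqpoch a p (n + int k) * v k" for k
        using z by (simp add: v_def power_int_add power_divide power_mult_distrib)
      thus ?thesis
        using has_sum_cmult_right[OF rqpoch_expansion[OF a ba(1)], of "z powi n" n] by simp
    qed
  qed (intro summable_rqpoch a z)
  from has_sum_cmult_left[OF this, of "qpoch_inf (b / a) p"] show ?thesis
    using nz by (simp add: V bilat_def mult_ac)
qed

text \<open>For \<open>b = p\<close> the factor \<open>(p\<^sup>n\<^sup>+\<^sup>1;p)\<^sub>\<infinity>\<close> kills the negative indices, and the bilateral
  sum is evaluated by the q-binomial theorem.\<close>
lemma bilat_eq:
  assumes a: "\<And>n. a * p powi n \<noteq> 1" "a \<noteq> 0" and z: "z \<noteq> 0" "norm z < 1"
    and pa: "norm (p / a) < 1" "norm (p / (a * z)) < 1"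
  shows "bilat a z = qpoch_inf p p * qpoch_inf (a * z) p * qpoch_inf (p / (a * z)) p /
           (qpoch_inf z p * qpoch_inf (p / a) p * qpoch_inf a p)"
proof -
  define f where "f = (\<lambda>n. z powi n * qpoch_inf (p * p powi n) p * rqpoch a p n)"
  have nzp: "qpoch_inf p p \<noteq> 0"
    by (rule qpoch_inf_nonzero_norm_less[OF norm_p norm_p])
  have f_neg: "f n = 0" if "n \<notin> range int" for n
  proof -
    from that have "n < 0" by (metis nonneg_int_cases not_le rangeI)
    then obtain m where n: "n = - int m - 1"
      by (intro that[of "nat (- n - 1)"]) auto
    have "p * p powi n * p ^ m = 1"
      using p_nz by (simp add: n power_int_diff power_int_minus)
    hence "qpoch (p * p powi n) p (Suc m) = 0"
      by (auto simp: qpoch_Suc)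
    thus ?thesis
      using qpoch_inf_split[OF norm_p, of "p * p powi n" "Suc m"] by (simp add: f_def)
  qed
  have f_nat: "f (int n) = qpoch_inf p p / qpoch_inf a p * (qpoch a p n / qpoch p p n * z ^ n)" for n
  proof -
    have nz: "qpoch p p n \<noteq> 0" by (rule qpoch_nonzero_norm_less[OF norm_p norm_p])
    show ?thesis
      using rqpoch_add[OF a(1), of 0 n] qpoch_inf_split[OF norm_p, of p n] nz nzp
      unfolding f_def by (simp add: rqpoch_def divide_inverse mult_ac)
  qed
  have "((\<lambda>n. f (int n)) has_sum (qpoch_inf p p / qpoch_inf a p * (qpoch_inf (a * z) p / qpoch_inf z p))) UNIV"
    unfolding f_nat
    by (rule has_sum_cmult_right[OF sums_imp_has_sum[OF q_binomial[OF norm_p z(2)] summable_norm_qbinomial[OF norm_p z(2)]]])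
  hence "(f has_sum (qpoch_inf p p / qpoch_inf a p * (qpoch_inf (a * z) p / qpoch_inf z p))) (range int)"
    by (subst has_sum_reindex) (auto simp: o_def)
  hence "(f has_sum (qpoch_inf p p / qpoch_inf a p * (qpoch_inf (a * z) p / qpoch_inf z p))) UNIV"
    by (rule has_sum_cong_neutral[THEN iffD1, rotated -1]) (use f_neg in auto)
  \<comment> \<open>The same series has now been summed in two ways, and the resulting equation is
    solved for \<open>bilat a z\<close>.\<close>
  hence "qpoch_inf p p / qpoch_inf a p * (qpoch_inf (a * z) p / qpoch_inf z p)
      = qpoch_inf (p / a) p / qpoch_inf (p / (a * z)) p * bilat a z"
    using has_sum_bilat_ratio[OF a z pa] unfolding f_def by (rule has_sum_unique)
  moreover have "qpoch_inf (p / a) p \<noteq> 0" "qpoch_inf (p / (a * z)) p \<noteq> 0"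
      "qpoch_inf z p \<noteq> 0" "qpoch_inf a p \<noteq> 0"
    using qpoch_inf_nonzero_norm_less[OF norm_p] pa z qpoch_inf_powi_nonzero[OF a(1), of 0] by auto
  ultimately show ?thesis by (simp add: field_simps)
qed

lemma bilat_shift:
  assumes "\<And>n. a * p powi n \<noteq> 1" "z \<noteq> 0"
  shows "bilat (a * p) z = bilat a z / z"
proof -
  have "bilat a z = (\<Sum>\<^sub>\<infinity>n. z powi (n + 1) * rqpoch a p (n + 1))"
    unfolding bilat_def
    by (rule infsum_reindex_bij_witness[of _ "\<lambda>n. n + 1" "\<lambda>n. n - 1"]) auto
  also have "\<dots> = (\<Sum>\<^sub>\<infinity>n. z * (z powi n * rqpoch (a * p) p n))"
    using assms p_nz by (intro infsum_cong) (simp add: rqpoch_def power_int_add mult_ac)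
  also have "\<dots> = z * bilat (a * p) z"
    unfolding bilat_def by (rule infsum_cmult_right')
  finally show ?thesis using assms by simp
qed

text \<open>With \<open>t = a / x\<close>, the sequence \<open>u\<^sub>k = 1 / ((t;p)\<^sub>k (a p\<^sup>n\<^sup>+\<^sup>k;p)\<^sub>\<infinity>)\<close> telescopes.\<close>
lemma rqpoch_over_linear:
  assumes a: "\<And>n. a * p powi n \<noteq> 1" and x: "x * p powi n \<noteq> 1" "x \<noteq> 0" and t: "norm (a / x) < 1"
  shows "(\<lambda>k. a / x * p ^ k / qpoch (a / x) p (Suc k) * rqpoch a p (n + int k)) sums
           ((1 / qpoch_inf (a / x) p - rqpoch a p n) / (1 - x * p powi n))"
proof -
  define t where "t = a / x"
  have nz: "qpoch t p k \<noteq> 0" for k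
    using qpoch_nonzero_norm_less[OF norm_p] t by (simp add: t_def)
  have nzi: "qpoch_inf t p \<noteq> 0"
    using qpoch_inf_nonzero_norm_less[OF norm_p] t by (simp add: t_def)
  define u where "u = (\<lambda>k. rqpoch a p (n + int k) / qpoch t p k)"
  have "u \<longlonglongrightarrow> 1 / qpoch_inf t p"
    unfolding u_def by (intro tendsto_divide rqpoch_tendsto qpoch_tendsto_qpoch_inf norm_p nzi)
  hence "(\<lambda>k. u (Suc k) - u k) sums (1 / qpoch_inf t p - u 0)"
    by (rule telescope_sums)
  hence "(\<lambda>k. (u (Suc k) - u k) / (1 - x * p powi n)) sums ((1 / qpoch_inf t p - u 0) / (1 - x * p powi n))"
    by (rule sums_divide)
  moreover have "(u (Suc k) - u k) / (1 - x * p powi n) = t * p ^ k / qpoch t p (Suc k) * rqpoch a p (n + int k)" for k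
  proof -
    have "rqpoch a p (n + int (Suc k)) = (1 - a * p powi (n + int k)) * rqpoch a p (n + int k)"
      using rqpoch_Suc[OF a, of "n + int k"] by (simp add: add_ac)
    moreover have "1 - t * p ^ k \<noteq> 0" using nz[of "Suc k"] by (simp add: qpoch_Suc)
    ultimately have "u (Suc k) = (1 - a * p powi (n + int k)) * rqpoch a p (n + int k) / qpoch t p (Suc k)"
        "u k = (1 - t * p ^ k) * rqpoch a p (n + int k) / qpoch t p (Suc k)"
      by (simp_all add: u_def qpoch_Suc)
    hence "u (Suc k) - u k =
        ((1 - a * p powi (n + int k)) - (1 - t * p ^ k)) * rqpoch a p (n + int k) / qpoch t p (Suc k)"
      by (simp only: diff_divide_distrib left_diff_distrib)
    \<comment> \<open>The choice t = a/x is what makes this difference a multiple of 1 - x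
      p^n.\<close>
    also have "(1 - a * p powi (n + int k)) - (1 - t * p ^ k) = t * p ^ k * (1 - x * p powi n)"
      using x p_nz by (simp add: t_def power_int_add field_simps)
    finally show ?thesis using x by simp
  qed
  ultimately show ?thesis by (simp add: t_def u_def)
qed

text \<open>\<open>rqpoch_over_linear\<close> expresses the summand as a constant multiple of z^n /
  (1 - x p^n) minus z^n times a telescoping series. The first part is a case of
  \<open>has_sum_bilat_ratio\<close>. The second is a convolution in which the shift by k turns p^k
  into (p/z)^k, whence the condition |p| < |z|.\<close>

lemma has_sum_rqpoch_over_linear:
  assumes a: "\<And>n. a * p powi n \<noteq> 1" "a \<noteq> 0"
    and x: "\<And>n. x * p powi n \<noteq> 1" "x \<noteq> 0" "norm (a / x) < 1"
    and z: "norm z < 1" "norm p < norm z"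
  shows "((\<lambda>n. z powi n * rqpoch a p n / (1 - x * p powi n)) has_sum
           (qpoch_inf p p / (qpoch_inf (a / x) p * qpoch_inf (p / z) p) * bilat x z -
            bilat a z * (\<Sum>k. a / x * (p / z) ^ k / qpoch (a / x) p (Suc k)))) UNIV"
proof -
  define t where "t = a / x"
  have z0: "z \<noteq> 0" using z norm_ge_zero[of p] by (metis norm_zero not_less)
  have pz: "norm (p / z) < 1" using z z0 by (simp add: norm_divide)
  have t: "norm t < 1" using x by (simp add: t_def)
  have nz: "qpoch t p k \<noteq> 0" for k
    by (rule qpoch_nonzero_norm_less[OF norm_p t])
  have nzi: "qpoch_inf t p \<noteq> 0"
    by (rule qpoch_inf_nonzero_norm_less[OF norm_p t])
  define v where "v = (\<lambda>k. t * (p / z) ^ k / qpoch t p (Suc k))"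
  have summ: "summable (\<lambda>k. norm (w ^ k * (t / qpoch t p (Suc k))))" if w: "norm w < 1" for w
  proof (rule summable_ratio_tendsto)
    show "w ^ Suc k * (t / qpoch t p (Suc (Suc k))) = (w / (1 - t * p ^ Suc k)) * (w ^ k * (t / qpoch t p (Suc k)))" for k
      by (simp add: qpoch_Suc mult_ac)
    show "(\<lambda>k. w / (1 - t * p ^ Suc k)) \<longlonglongrightarrow> w / (1 - t * 0)"
      using LIMSEQ_power_zero[OF norm_p, THEN LIMSEQ_Suc] by (intro tendsto_intros) auto
    show "norm (w / (1 - t * 0)) < 1" using w by simp
  qed
  have v: "summable (\<lambda>k. norm (v k))"
    using summ[OF pz] by (simp add: v_def mult_ac)
  obtain C where C: "C > 0" "\<And>n. norm (rqpoch a p n) \<le> C"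
    using rqpoch_bounded[OF a] by blast
  have inner: "((\<lambda>k. z powi (n + int k) * rqpoch a p (n + int k) * v k) has_sum
      z powi n * ((1 / qpoch_inf t p - rqpoch a p n) / (1 - x * p powi n))) UNIV" for n
  proof -
    have "summable (\<lambda>k. norm (t * p ^ k / qpoch t p (Suc k) * rqpoch a p (n + int k)))"
    proof (rule summable_comparison_test')
      show "summable (\<lambda>k. norm (p ^ k * (t / qpoch t p (Suc k))) * C)"
        by (intro summable_mult2 summ norm_p)
      show "norm (norm (t * p ^ k / qpoch t p (Suc k) * rqpoch a p (n + int k))) \<le> norm (p ^ k * (t / qpoch t p (Suc k))) * C" for k
        using mult_left_mono[OF C(2)[of "n + int k"], of "norm (p ^ k * (t / qpoch t p (Suc k)))"]
        by (simp add: norm_mult norm_divide mult_ac)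
    qed
    hence "((\<lambda>k. t * p ^ k / qpoch t p (Suc k) * rqpoch a p (n + int k)) has_sum
        ((1 / qpoch_inf t p - rqpoch a p n) / (1 - x * p powi n))) UNIV"
      using rqpoch_over_linear[OF a(1) x(1,2,3)] unfolding t_def by (intro sums_imp_has_sum)
    from has_sum_cmult_right[OF this, of "z powi n"] show ?thesis
      using z0 by (simp add: v_def power_int_add power_divide mult_ac)
  qed
  have 1: "((\<lambda>n. z powi n * ((1 / qpoch_inf t p - rqpoch a p n) / (1 - x * p powi n))) has_sum
      bilat a z * (\<Sum>k. v k)) UNIV"
    unfolding bilat_def
    by (rule has_sum_convolution[OF summable_rqpoch[OF a z0 z(1)] v inner])
  \<comment> \<open>Taking b = x p, the two infinite products cancel except for the first factor,
    leaving 1 / (1 - x p^n).\<close>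
  have lin: "z powi n * qpoch_inf (x * p * p powi n) p * rqpoch x p n = z powi n / (1 - x * p powi n)" for n
  proof -
    define E where "E = qpoch_inf (x * p * p powi n) p"
    have E: "qpoch_inf (x * p powi n) p = (1 - x * p powi n) * E"
      using qpoch_inf_step[of x n] p_nz by (simp add: E_def power_int_add mult_ac)
    hence "E \<noteq> 0" using qpoch_inf_powi_nonzero[OF x(1), of n] by auto
    thus ?thesis by (simp add: rqpoch_def E E_def[symmetric] divide_simps)
  qed
  have 2: "((\<lambda>n. z powi n / (1 - x * p powi n)) has_sum
           (qpoch_inf p p / qpoch_inf (p / z) p * bilat x z)) UNIV"
    using has_sum_bilat_ratio[OF x(1,2) z0 z(1), of "x * p"] x(2) norm_p pz
    by (simp add: lin)
  have "((\<lambda>n. 1 / qpoch_inf t p * (z powi n / (1 - x * p powi n)) -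
         z powi n * ((1 / qpoch_inf t p - rqpoch a p n) / (1 - x * p powi n))) has_sum
       (1 / qpoch_inf t p * (qpoch_inf p p / qpoch_inf (p / z) p * bilat x z) - bilat a z * (\<Sum>k. v k))) UNIV"
    using has_sum_add[OF has_sum_cmult_right[OF 2, of "1 / qpoch_inf t p"] has_sum_uminusI[OF 1]] by simp
  moreover have "1 / qpoch_inf t p * (z powi n / (1 - x * p powi n)) -
         z powi n * ((1 / qpoch_inf t p - rqpoch a p n) / (1 - x * p powi n)) =
       z powi n * rqpoch a p n / (1 - x * p powi n)" for n
    using x(1)[of n] by (simp add: right_diff_distrib diff_divide_distrib)
  ultimately show ?thesis by (simp add: t_def v_def)
qed

end

section \<open>The bilateral completion of the mock theta series\<close>

locale q_square_base =
  fixes q p :: complex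
  assumes norm_q: "norm q < 1" and q_nz: "q \<noteq> 0" and qq: "q * q = p"
begin

sublocale q_base p
proof
  have "norm q * norm q < 1 * 1" using norm_q by (intro mult_strict_mono') auto
  thus "norm p < 1" by (simp add: norm_mult flip: qq)
  show "p \<noteq> 0" using q_nz qq by auto
qed

abbreviation e :: "complex \<Rightarrow> complex" where "e x \<equiv> qpoch_inf x p"

lemma p_powi: "p powi n = q powi n * q powi n"
  by (simp add: power_int_mult_distrib flip: qq)

lemmas q_powi_add = power_int_add[OF disjI1[OF q_nz]]

lemma q_powi_norm_neq_1:
  assumes "m \<noteq> 0"
  shows "norm (q powi m) \<noteq> 1"
proof (cases m rule: int_cases2)
  case (nonneg k)
  hence "norm q ^ k < 1" using assms norm_q by (simp add: power_less_one_iff)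
  thus ?thesis using nonneg by (simp add: norm_power)
next
  case (nonpos k)
  hence "norm q ^ k < 1" using assms norm_q by (simp add: power_less_one_iff)
  thus ?thesis using nonpos by (simp add: norm_power norm_inverse power_int_minus)
qed

lemma q_p_powi_neq_1: "q * p powi n \<noteq> 1"
proof
  assume "q * p powi n = 1"
  moreover have "q powi (1 + n + n) = q * p powi n"
    unfolding q_powi_add p_powi by simp
  moreover have "1 + n + n \<noteq> 0" by presburger
  ultimately show False using q_powi_norm_neq_1[of "1 + n + n"] by (metis norm_one)
qed

lemma inverse_q_p_powi_neq_1: "inverse q * p powi n \<noteq> 1"
proof -
  have "inverse q * p powi n = q * p powi (n - 1)"
    using q_nz p_nz by (simp add: power_int_diff field_simps flip: qq)
  thus ?thesis using q_p_powi_neq_1 by metis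
qed

lemma minus_p_powi_neq_1: "- 1 * p powi n \<noteq> 1"
proof
  assume h: "- 1 * p powi n = 1"
  have "q powi (n + n) = p powi n"
    unfolding q_powi_add p_powi by simp
  hence "norm (q powi (n + n)) = norm (- 1 * p powi n)" by simp
  hence "norm (q powi (n + n)) = 1" unfolding h by (simp only: norm_one)
  hence "n + n = 0" using q_powi_norm_neq_1 by blast
  hence "n = 0" by simp
  thus False using h by simp
qed

lemma one_plus_p_powi_nonzero: "1 + p powi n \<noteq> 0"
proof
  assume "1 + p powi n = 0"
  hence "- 1 * p powi n = 1" by (simp add: add_eq_0_iff)
  thus False using minus_p_powi_neq_1 by blast
qed

lemma e_nonzero: "norm x < 1 \<Longrightarrow> e x \<noteq> 0"
  by (rule qpoch_inf_nonzero_norm_less[OF norm_p])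

lemma e_minus_1: "e (- 1) = 2 * e (- p)"
  using qpoch_inf_head[OF norm_p, of "- 1"] by simp

lemma e_minus_p_powi: "e (- p * p powi (n - 1)) = (1 + p powi n) * e (- p * p powi n)"
proof -
  have "- p * p powi (n - 1) = - 1 * p powi n"
    using p_nz by (simp add: power_int_diff)
  moreover have "- p * p powi n = - 1 * p powi (n + 1)"
    using p_nz by (simp add: power_int_add)
  ultimately show ?thesis using qpoch_inf_step[of "- 1" n] by (simp del: mult_minus_left)
qed

text \<open>This is (-p;p)_\<infinity> times (-1)^n q^(n^2) / (-p;p)_n, with n running over all
  integers.\<close>

definition A :: "int \<Rightarrow> complex" where
  "A n = (- 1) powi n * q powi (n ^ 2) * e (- p * p powi n)"

lemma A_pred: "A (n - 1) = - q * (1 + p powi (- n)) * A n"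
proof -
  have "(n - 1) ^ 2 = n ^ 2 + (1 - 2 * n)" by (simp add: power2_eq_square algebra_simps)
  hence "q powi ((n - 1) ^ 2) = q powi (n ^ 2) * (q powi (1 - 2 * n))"
    using q_nz by (simp add: power_int_add del: power2_diff)
  also have "q powi (1 - 2 * n) = q * p powi (- n)"
  proof -
    have "1 - 2 * n = 1 + - n + - n" by simp
    thus ?thesis by (simp only: q_powi_add p_powi power_int_1_right mult.assoc)
  qed
  finally have 1: "q powi ((n - 1) ^ 2) = q powi (n ^ 2) * (q * p powi (- n))" .
  have 2: "(- 1 :: complex) powi (n - 1) = - ((- 1) powi n)"
    by (simp add: power_int_diff)
  have 3: "p powi (- n) * (1 + p powi n) = 1 + p powi (- n)"
    using p_nz by (simp add: power_int_minus field_simps)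
  have "A (n - 1) = - q * (p powi (- n) * (1 + p powi n)) * A n"
    unfolding A_def e_minus_p_powi 1 2 by (simp add: mult_ac)
  thus ?thesis by (simp only: 3)
qed

lemma A_Suc: "A (n + 1) = - q * p powi n / (1 + p powi (n + 1)) * A n"
proof -
  have "A n = - q * (1 + p powi (- (n + 1))) * A (n + 1)"
    using A_pred[of "n + 1"] by simp
  also have "1 + p powi (- (n + 1)) = (1 + p powi (n + 1)) / (p powi (n + 1))"
    unfolding power_int_minus using p_nz by (simp add: field_simps)
  finally have "A n * p powi (n + 1) = - q * (1 + p powi (n + 1)) * A (n + 1)"
    using p_nz by (simp add: field_simps)
  moreover have "p powi (n + 1) = p powi n * q * q"
    using p_nz by (simp add: power_int_add flip: qq)
  ultimately have "q * (- q * p powi n * A n) = q * ((1 + p powi (n + 1)) * A (n + 1))"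
    by (simp only: mult_minus_left mult_minus_right mult_ac minus_equation_iff)
  hence "- q * p powi n * A n = (1 + p powi (n + 1)) * A (n + 1)"
    using q_nz mult_left_cancel by blast
  hence "A (n + 1) * (1 + p powi (n + 1)) = - q * p powi n * A n"
    by (simp only: mult.commute)
  thus ?thesis
    by (simp only: times_divide_eq_left nonzero_eq_divide_eq[OF one_plus_p_powi_nonzero])
qed

text \<open>The term ratio tends to 0 on the right because of the quadratic exponent. On the left
  the infinite product offsets that decay, and the ratio tends to -q.\<close>

lemma summable_A: "(\<lambda>n. norm (A n)) summable_on UNIV"
proof (rule summable_on_int_ratio)
  show "A (int n + 1) = (- q * p ^ n / (1 + p ^ Suc n)) * A (int n)" for n
    using A_Suc[of "int n"] power_int_of_nat[of p "Suc n"]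
    unfolding of_nat_Suc by (simp add: add.commute del: power_Suc)
  show "(\<lambda>n. - q * p ^ n / (1 + p ^ Suc n)) \<longlonglongrightarrow> - q * 0 / (1 + 0)"
    using LIMSEQ_power_zero[OF norm_p, THEN LIMSEQ_Suc] LIMSEQ_power_zero[OF norm_p]
    by (intro tendsto_intros) (use norm_p in auto)
  show "A (- int n - 1) = (- q * (1 + p ^ n)) * A (- int n)" for n
    using A_pred[of "- int n"] by simp
  show "(\<lambda>n. - q * (1 + p ^ n)) \<longlonglongrightarrow> - q * (1 + 0)"
    by (intro tendsto_intros LIMSEQ_power_zero norm_p)
qed (use norm_q in auto)

text \<open>\<open>A_pred\<close> iterated k times: each step yields a factor -q, which pairs with
  one from (-q)^k to give p. The result has the form needed for the q-binomial theorem with argument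
  p.\<close>

lemma A_minus:
  "A (m - int k) * (- q) ^ k = A m * (qpoch (- (p powi (- m))) p k * p ^ k)"
proof (induction k)
  case (Suc k)
  have "A (m - int (Suc k)) * (- q) ^ Suc k = A (m - int k - 1) * (- q) ^ Suc k"
    by (simp add: algebra_simps)
  also have "\<dots> = p * (1 + p powi (- (m - int k))) * (A (m - int k) * (- q) ^ k)"
    unfolding A_pred by (simp add: mult_ac flip: qq)
  also have "p powi (- (m - int k)) = p powi (- m) * p ^ k"
    using p_nz powi_shift[of 1 "- m" k] by (simp add: algebra_simps)
  finally show ?case
    unfolding Suc by (simp add: qpoch_Suc mult_ac)
qed simp

text \<open>Quasi-periodicity of \<open>(x;p)\<^sub>\<infinity> (p/x;p)\<^sub>\<infinity>\<close>, evaluated at \<open>x = - p\<^sup>m\<close>.\<close>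
lemma theta_minus_p_powi:
  "q powi (m ^ 2) * e (- p * p powi m) * e (- p * p powi (- m)) = 2 * (e (- p))\<^sup>2 * q powi m / (1 + p powi m)"
proof -
  \<comment> \<open>V carries all dependence on m on one side, so the claim becomes that V is
    constant, with value read off at m = 0.\<close>
  define V where "V = (\<lambda>m. q powi (m ^ 2) * e (- p * p powi m) * e (- p * p powi (- m)) * (1 + p powi m) * q powi (- m))"
  have step: "V (m + 1) = V m" for m
  proof -
    have "(m + 1) ^ 2 = m ^ 2 + (1 + m + m)" by (simp add: power2_eq_square algebra_simps)
    hence 1: "q powi ((m + 1) ^ 2) = q powi (m ^ 2) * (q * q powi m * q powi m)"
      by (simp only: q_powi_add power_int_1_right mult.assoc)
    have 2: "e (- p * p powi m) = (1 + p powi (m + 1)) * e (- p * p powi (m + 1))"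
      using e_minus_p_powi[of "m + 1"] by simp
    have 3: "e (- p * p powi (- (m + 1))) = (1 + p powi (- m)) * e (- p * p powi (- m))"
    proof -
      have "- (m + 1) = - m - 1" by simp
      thus ?thesis using e_minus_p_powi[of "- m"] by (simp only:)
    qed
    have 4: "p powi m = q powi m * q powi m"
      by (rule p_powi)
    have 5: "q powi (- (m + 1)) = q powi (- m) / q"
    proof -
      have "- (m + 1) = - m + - 1" by simp
      thus ?thesis by (simp only: q_powi_add divide_inverse power_int_minus power_int_1_right)
    qed
    have 6: "p powi m * (1 + p powi (- m)) = 1 + p powi m"
      using p_nz by (simp add: power_int_minus field_simps)
    have "V (m + 1) = q powi (m ^ 2) * (p powi m * (1 + p powi (- m))) * e (- p * p powi (m + 1)) *
        e (- p * p powi (- m)) * (1 + p powi (m + 1)) * q powi (- m)"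
      unfolding V_def 1 3 4 5 using q_nz by simp
    also have "\<dots> = V m"
      unfolding 6 V_def 2 by (simp add: mult_ac)
    finally show ?thesis .
  qed
  have "V m = V 0"
  proof (induction m rule: int_induct[of _ 0])
    case (step2 i)
    thus ?case using step[of "i - 1"] by simp
  qed (simp_all add: step)
  also have "V 0 = 2 * (e (- p))\<^sup>2" by (simp add: V_def power2_eq_square)
  finally show ?thesis
    using one_plus_p_powi_nonzero[of m] q_nz by (simp add: V_def power_int_minus field_simps)
qed

text \<open>Up to the factor -q / (1 + q), Fine's function F(0,-q;-q) in base p. It is the series in
  \<open>has_sum_rqpoch_over_linear\<close> at a = q, x = -1, z = -q.\<close>

definition fine_sum :: complex where
  "fine_sum = (\<Sum>k. (- q) ^ Suc k / qpoch (- q) p (Suc k))"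

text \<open>The summand of \<open>S\<^sub>3(1;q)\<close>, extended to all integers \<open>n\<close>.\<close>
definition bterm :: "int \<Rightarrow> complex" where
  "bterm n = e q / (2 * (e (- p))\<^sup>2) * (A n * e (- p * p powi n) * rqpoch q p n)"

lemma bilat_minus_1: "bilat (- 1) (- q) = e p * (e q)\<^sup>2 / (2 * e (- q) * (e (- p))\<^sup>2)"
proof -
  have "p / q = q" using q_nz by (simp flip: qq)
  thus ?thesis
    using bilat_eq[OF minus_p_powi_neq_1, of "- q"] q_nz norm_q norm_p
    by (simp add: e_minus_1 power2_eq_square mult_ac)
qed

text \<open>At a = q and z = -q the quotient p/(a z) is -1, outside the range of
  \<open>bilat_eq\<close>. The evaluation is made at a = 1/q, where the quotient is -p, and carried
  over by \<open>bilat_shift\<close>.\<close>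

lemma bilat_q: "bilat q (- q) = 2 * e p * (e (- p))\<^sup>2 / (e (- q) * (e q)\<^sup>2)"
proof -
  have "inverse q * p = q" using q_nz by (simp flip: qq)
  hence h1: "e (inverse q) = (1 - inverse q) * e q"
    using qpoch_inf_head[OF norm_p, of "inverse q"] \<open>inverse q * p = q\<close> by simp
  have h2: "e q = (1 - q) * e (q ^ 3)"
    using qpoch_inf_head[OF norm_p, of q] by (simp add: power3_eq_cube mult_ac flip: qq)
  have q1: "q \<noteq> 1" using norm_q by auto
  have "e q \<noteq> 0" using e_nonzero[OF norm_q] .
  have "bilat q (- q) = bilat (inverse q) (- q) / (- q)"
    using bilat_shift[OF inverse_q_p_powi_neq_1, of "- q"] q_nz \<open>inverse q * p = q\<close> by simp
  also have "bilat (inverse q) (- q) = e p * e (- 1) * e (- p) / (e (- q) * e (q ^ 3) * e (inverse q))"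
  proof -
    have "norm (q ^ 3) < 1" using norm_q by (simp add: norm_power power_less_one_iff)
    moreover have "p / inverse q = q ^ 3"
      by (simp add: power3_eq_cube divide_inverse flip: qq)
    ultimately show ?thesis
      using bilat_eq[OF inverse_q_p_powi_neq_1, of "- q"] q_nz norm_q norm_p by simp
  qed
  also have "e (q ^ 3) * e (inverse q) = - ((e q)\<^sup>2 / q)"
    unfolding h1 unfolding h2 using q_nz by (simp add: field_simps power2_eq_square)
  hence "e (- q) * e (q ^ 3) * e (inverse q) = - (e (- q) * (e q)\<^sup>2 / q)"
    by (simp add: mult.assoc)
  finally show ?thesis
    using q_nz by (simp add: e_minus_1 power2_eq_square mult_ac)
qed

text \<open>The double series F is summed in two ways. Along m - k = n,
  \<open>rqpoch_expansion\<close> with b = -p gives s, a multiple of \<open>bterm\<close>. At fixed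
  m, \<open>A_minus\<close> and the q-binomial theorem produce a theta product, and
  \<open>theta_minus_p_powi\<close> reduces it to r, whose denominator is linear in p^m. Then
  \<open>has_sum_rqpoch_over_linear\<close> sums r.\<close>

lemma has_sum_bterm:
  "(bterm has_sum ((e q) ^ 3 * e p / (2 * (e (- q))\<^sup>2 * (e (- p))\<^sup>2) - 2 * (e (- p))\<^sup>2 / e q * fine_sum)) UNIV"
proof -
  define v where "v = (\<lambda>k. (- q) ^ k / qpoch p p k)"
  define F where "F = (\<lambda>m k. A (m - int k) * rqpoch q p m * v k)"
  define s where "s = (\<lambda>n. A n * (e (- p * p powi n) / e (- q) * rqpoch q p n))"
  define r where "r = (\<lambda>m. 2 * (e (- p))\<^sup>2 / e p * ((- q) powi m * rqpoch q p m / (1 - (- 1) * p powi m)))"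
  have nz: "e q \<noteq> 0" "e (- q) \<noteq> 0" "e p \<noteq> 0" "e (- p) \<noteq> 0"
    using norm_q norm_p by (auto intro!: e_nonzero)
  have mpq: "- p / q = - q" using q_nz by (simp flip: qq)
  have pmq: "p / (- q) = - q" using q_nz by (simp flip: qq)
  have pq: "norm p < norm (- q)"
    using norm_q q_nz mult_strict_right_mono[of "norm q" 1 "norm q"] by (simp add: norm_mult flip: qq)
  have v: "summable (\<lambda>k. norm (v k))"
    unfolding v_def by (rule summable_power_over_qpoch) (use norm_q in simp)
  have "(\<lambda>k. norm (v k)) summable_on UNIV"
    using v by (simp add: summable_on_UNIV_nonneg_real_iff)
  from summable_on_times_norm[OF summable_A this]
  have Av: "(\<lambda>(n, k). norm (A n * v k)) summable_on UNIV \<times> UNIV" .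
  have Av': "(\<lambda>(m, k). norm (A (m - int k) * v k)) summable_on UNIV \<times> UNIV"
    using Av by (subst summable_on_reindex_bij_witness[of _ "\<lambda>(n, k). (n + int k, k)" "\<lambda>(m, k). (m - int k, k)"]) auto
  \<comment> \<open>Since \<open>rqpoch\<close> is bounded, F is dominated by the sheared product
    family A (m - k) * v k.\<close>
  obtain C where C: "C > 0" "\<And>n. norm (rqpoch q p n) \<le> C"
    using rqpoch_bounded[OF q_p_powi_neq_1 q_nz] by blast
  have F_summ: "(\<lambda>(m, k). norm (F m k)) summable_on UNIV \<times> UNIV"
  proof (rule summable_on_comparison_test)
    show "(\<lambda>x. C * (case x of (m, k) \<Rightarrow> norm (A (m - int k) * v k))) summable_on UNIV \<times> UNIV"
      by (rule summable_on_cmult_right[OF Av'])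
    show "(case x of (m, k) \<Rightarrow> norm (F m k)) \<le> C * (case x of (m, k) \<Rightarrow> norm (A (m - int k) * v k))" for x
      using mult_right_mono[OF C(2)[of "fst x"], of "norm (A (fst x - int (snd x)) * v (snd x))"]
      by (simp add: F_def norm_mult case_prod_unfold mult_ac)
  qed (auto simp: case_prod_unfold)
  have F_s: "((\<lambda>k. F (n + int k) k) has_sum s n) UNIV" for n
    using has_sum_cmult_right[OF rqpoch_expansion[OF q_p_powi_neq_1 q_nz, of "- p" n], of "A n"] norm_q
    unfolding mpq F_def s_def v_def by (simp add: mult_ac)
  have F_r: "((\<lambda>k. F m k) has_sum r m) UNIV" for m
  proof -
    have "((\<lambda>k. qpoch (- (p powi (- m))) p k / qpoch p p k * p ^ k) has_sum
        (e (- (p powi (- m)) * p) / e p)) UNIV"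
      by (rule sums_imp_has_sum[OF q_binomial[OF norm_p norm_p] summable_norm_qbinomial[OF norm_p norm_p]])
    from has_sum_cmult_right[OF this, of "A m * rqpoch q p m"]
    have "((\<lambda>k. F m k) has_sum A m * rqpoch q p m * (e (- (p powi (- m)) * p) / e p)) UNIV"
    proof (rule has_sum_cong[THEN iffD1, rotated])
      fix k
      have "F m k = (A (m - int k) * (- q) ^ k) * rqpoch q p m / qpoch p p k"
        by (simp add: F_def v_def)
      thus "A m * rqpoch q p m * (qpoch (- (p powi (- m))) p k / qpoch p p k * p ^ k) = F m k"
        unfolding A_minus by simp
    qed
    moreover have "A m * rqpoch q p m * (e (- (p powi (- m)) * p) / e p) = r m"
    proof -
      have "A m * e (- (p powi (- m)) * p) = (- 1) powi m * (q powi (m ^ 2) * e (- p * p powi m) * e (- p * p powi (- m)))"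
        by (simp add: A_def mult_ac)
      also have "\<dots> = (- 1) powi m * (2 * (e (- p))\<^sup>2 * q powi m / (1 + p powi m))"
        by (simp only: theta_minus_p_powi)
      also have "\<dots> = 2 * (e (- p))\<^sup>2 * (- q) powi m / (1 + p powi m)"
        using power_int_mult_distrib[of "- 1" q m] by simp
      finally have "A m * e (- (p powi (- m)) * p) = 2 * (e (- p))\<^sup>2 * (- q) powi m / (1 + p powi m)" .
      hence "A m * e (- (p powi (- m)) * p) * (rqpoch q p m / e p) =
         2 * (e (- p))\<^sup>2 * (- q) powi m / (1 + p powi m) * (rqpoch q p m / e p)"
        by (simp only:)
      thus ?thesis by (simp add: r_def mult_ac)
    qed
    ultimately show ?thesis by simp
  qed
  define X where "X = e p / (e (- q) * e (- q)) * bilat (- 1) (- q) - bilat q (- q) * fine_sum"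
  have "(\<Sum>k. q / (- 1) * (p / (- q)) ^ k / qpoch (q / (- 1)) p (Suc k)) = fine_sum"
    unfolding fine_sum_def pmq by simp
  moreover have "q / (- 1) = - q" by simp
  ultimately have "((\<lambda>n. (- q) powi n * rqpoch q p n / (1 - (- 1) * p powi n)) has_sum X) UNIV"
    using has_sum_rqpoch_over_linear[OF q_p_powi_neq_1 q_nz minus_p_powi_neq_1, of "- q"] norm_q q_nz pq
    unfolding X_def pmq by simp
  hence r: "(r has_sum (2 * (e (- p))\<^sup>2 / e p * X)) UNIV"
    unfolding r_def by (rule has_sum_cmult_right)
  obtain S where S: "(r has_sum S) UNIV" "(s has_sum S) UNIV"
    using has_sum_shear[OF F_summ F_r F_s] by (elim exE conjE)
  have "(s has_sum (2 * (e (- p))\<^sup>2 / e p * X)) UNIV"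
    using S(2) unfolding has_sum_unique[OF S(1) r] .
  hence "((\<lambda>n. e q * e (- q) / (2 * (e (- p))\<^sup>2) * s n) has_sum
      (e q * e (- q) / (2 * (e (- p))\<^sup>2) * (2 * (e (- p))\<^sup>2 / e p * X))) UNIV"
    by (rule has_sum_cmult_right)
  also have "(\<lambda>n. e q * e (- q) / (2 * (e (- p))\<^sup>2) * s n) = bterm"
    using nz by (auto simp: fun_eq_iff bterm_def s_def)
  also have "e q * e (- q) / (2 * (e (- p))\<^sup>2) * (2 * (e (- p))\<^sup>2 / e p * X) = e q * e (- q) / e p * X"
    using nz by simp
  also have "\<dots> = (e q) ^ 3 * e p / (2 * (e (- q))\<^sup>2 * (e (- p))\<^sup>2) - 2 * (e (- p))\<^sup>2 / e q * fine_sum"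
  proof -
    have "e q * e (- q) / e p * (e p / (e (- q) * e (- q)) * bilat (- 1) (- q))
        = (e q) ^ 3 * e p / (2 * (e (- q))\<^sup>2 * (e (- p))\<^sup>2)"
      unfolding bilat_minus_1 using nz by (simp add: power2_eq_square power3_eq_cube mult_ac)
    moreover have "e q * e (- q) / e p * (bilat q (- q) * fine_sum) = 2 * (e (- p))\<^sup>2 / e q * fine_sum"
      unfolding bilat_q using nz by (simp add: power2_eq_square)
    ultimately show ?thesis
      unfolding X_def right_diff_distrib by (simp only:)
  qed
  finally show ?thesis .
qed

section \<open>The two halves of the bilateral series\<close>

lemma bterm_pred:
  "bterm (n - 1) = - q * (1 + p powi (- n)) * (1 + p powi n) / (1 - q * p powi (n - 1)) * bterm n"
proof -
  have alg: "c * (a * x * (b * y) * (inverse d * z)) = a * b / d * (c * (x * y * z))" for a b c d x y z :: complex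
    by (simp add: divide_inverse)
  show ?thesis
    unfolding bterm_def A_pred e_minus_p_powi rqpoch_pred[OF q_p_powi_neq_1, of n] by (rule alg)
qed

definition cterm :: "nat \<Rightarrow> complex" where
  "cterm n = q ^ (2 * n + 2) * (qpoch (- p) p n)\<^sup>2 / qpoch q p (n + 1)"

lemma bterm_nat:
  "bterm (int n) = qpoch q p n * (-1) ^ n * q ^ (n\<^sup>2) / (qpoch (-1) p (n + 1) * qpoch (- p) p n)"
proof -
  define x y where "x = e (- p * p ^ n)" and "y = e (q * p ^ n)"
  have s1: "e q = qpoch q p n * y"
    unfolding y_def by (rule qpoch_inf_split[OF norm_p])
  have s2: "e (- p) = qpoch (- p) p n * x"
    unfolding x_def by (rule qpoch_inf_split[OF norm_p])
  have s3: "qpoch (- 1) p (n + 1) = 2 * qpoch (- p) p n"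
    by (simp add: qpoch_Suc_head)
  have "qpoch q p n * y \<noteq> 0"
    unfolding s1[symmetric] by (rule e_nonzero[OF norm_q])
  moreover have "qpoch (- p) p n * x \<noteq> 0"
    unfolding s2[symmetric] by (rule e_nonzero) (simp add: norm_p)
  ultimately have nz: "y \<noteq> 0" "x \<noteq> 0" by simp_all
  have Q: "q powi (int n)\<^sup>2 = q ^ (n\<^sup>2)"
    using power_int_of_nat[of q "n\<^sup>2"] by (simp only: of_nat_power)
  have alg: "a * y / (2 * (b * x)\<^sup>2) * (s * Q * x * x * inverse y) = a * s * Q / (2 * b * b)"
    if "y \<noteq> 0" "x \<noteq> 0" for a b s Q x y :: complex
    using that by (simp add: field_simps power2_eq_square)
  have "bterm (int n) = e q / (2 * (e (- p))\<^sup>2) * ((-1) ^ n * q ^ (n\<^sup>2) * x * x * inverse y)"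
    unfolding bterm_def A_def rqpoch_def power_int_of_nat x_def y_def Q by simp
  also have "\<dots> = qpoch q p n * (-1) ^ n * q ^ (n\<^sup>2) / (2 * qpoch (- p) p n * qpoch (- p) p n)"
    unfolding s1 s2 by (rule alg[OF nz])
  finally show ?thesis unfolding s3 .
qed

text \<open>Downward recursion from the value 1/2 at index 0. The index -n - 1 makes n = 0
  correspond to the first negative term.\<close>

lemma bterm_neg: "bterm (- int n - 1) = 2 * cterm n"
proof (induction n)
  case 0
  have "bterm 0 = 1 / 2" using bterm_nat[of 0] by (simp add: qpoch_def)
  moreover have "q * p powi (0 - 1) = inverse q"
    using q_nz by (simp add: power_int_minus flip: qq)
  moreover have "1 - inverse q = - ((1 - q) / q)" using q_nz by (simp add: field_simps)
  ultimately have "bterm (0 - 1) = - q * 2 * 2 / (- ((1 - q) / q)) * (1 / 2)"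
    unfolding bterm_pred[of 0] by (simp only: minus_zero power_int_0_right) simp
  also have "\<dots> = 2 * (q * q / (1 - q))"
    by (simp add: field_simps)
  finally show ?case
    by (simp add: cterm_def qpoch_def power2_eq_square)
next
  case (Suc n)
  define y where "y = p ^ Suc n"
  have y: "y \<noteq> 0" using p_nz by (simp add: y_def)
  have n1: "p powi (- int n - 1) = inverse y"
  proof -
    have "- int n - 1 = - int (Suc n)" by simp
    thus ?thesis unfolding y_def by (simp only: power_int_minus power_int_of_nat)
  qed
  have n2: "p powi (- (- int n - 1)) = y"
  proof -
    have "- (- int n - 1) = int (Suc n)" by simp
    thus ?thesis unfolding y_def by (simp only: power_int_of_nat)
  qed
  have n3: "p powi (- int n - 1 - 1) = inverse (p * y)"
  proof -
    have "- int n - 1 - 1 = (- int n - 1) + - 1" by simp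
    hence "p powi (- int n - 1 - 1) = p powi (- int n - 1) * p powi (- 1)"
      using power_int_add[OF disjI1[OF p_nz], of "- int n - 1" "- 1"] by (simp only:)
    also have "\<dots> = inverse y * inverse p"
      unfolding n1 by (simp add: power_int_minus)
    finally show ?thesis by simp
  qed
  have ny: "1 - q * y \<noteq> 0" using q_p_powi_neq_1[of "int (Suc n)"] unfolding y_def by (simp only: power_int_of_nat) simp
  have "q * inverse (p * y) = inverse (q * y)" using q_nz by (simp flip: qq)
  hence "- q * (1 + y) * (1 + inverse y) / (1 - q * inverse (p * y)) = - q * (1 + y) * (1 + inverse y) / (1 - inverse (q * y))"
    by simp
  \<comment> \<open>Clearing the inverses of y and q y combines both numerator factors into a square
    and the two factors q into p.\<close>
  also have "\<dots> = p * (1 + y)\<^sup>2 / (1 - q * y)"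
  proof -
    have "1 - inverse (q * y) = - ((1 - q * y) / (q * y))" using q_nz y by (simp add: field_simps)
    moreover have "1 + inverse y = (1 + y) / y" using y by (simp add: field_simps)
    ultimately show ?thesis using ny y q_nz by (simp add: power2_eq_square mult_ac flip: qq)
  qed
  finally have "bterm (- int n - 1 - 1) = p * (1 + y)\<^sup>2 / (1 - q * y) * bterm (- int n - 1)"
    unfolding bterm_pred[of "- int n - 1"] n1 n2 n3 by simp
  also have "\<dots> = 2 * (p * (1 + y)\<^sup>2 / (1 - q * y) * cterm n)"
    unfolding Suc by simp
  also have "p * (1 + y)\<^sup>2 / (1 - q * y) * cterm n = cterm (Suc n)"
  proof -
    have 1: "q ^ (2 * Suc n + 2) = p * q ^ (2 * n + 2)" by (simp flip: qq)
    have 2: "qpoch (- p) p (Suc n) = qpoch (- p) p n * (1 + y)"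
      by (simp add: qpoch_Suc y_def)
    have 3: "qpoch q p (Suc n + 1) = qpoch q p (n + 1) * (1 - q * y)"
      by (simp add: qpoch_Suc y_def)
    have "p * a\<^sup>2 / b * (c * d\<^sup>2 / f) = p * c * (d * a)\<^sup>2 / (f * b)" for a b c d f
      by (simp add: power_mult_distrib mult_ac)
    thus ?thesis unfolding cterm_def 1 2 3 .
  qed
  finally show ?case by simp
qed

text \<open>Separates even and odd exponents of q, which brings \<open>theta_J_bar 0 1 q\<close>
  from base q to base p.\<close>

lemma qpoch_inf_even_odd: "qpoch_inf x q = e x * e (x * q)"
proof (rule LIMSEQ_unique)
  have "qpoch x q (2 * n) = qpoch x p n * qpoch (x * q) p n" for n
    by (induction n) (simp_all add: qpoch_Suc power_mult power2_eq_square power_mult_distrib mult_ac flip: qq)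
  thus "(\<lambda>n. qpoch x q (2 * n)) \<longlonglongrightarrow> e x * e (x * q)"
    by (auto intro!: tendsto_mult qpoch_tendsto_qpoch_inf norm_p)
  show "(\<lambda>n. qpoch x q (2 * n)) \<longlonglongrightarrow> qpoch_inf x q"
    by (rule LIMSEQ_subseq_LIMSEQ[OF qpoch_tendsto_qpoch_inf[OF norm_q], unfolded o_def])
       (simp add: strict_mono_def)
qed

lemma theta_quotient: "(theta_J 1 2 q)\<^sup>2 / theta_J_bar 0 1 q = (e q) ^ 3 * e p / (2 * (e (- q))\<^sup>2 * (e (- p))\<^sup>2)"
proof -
  have nz: "e q \<noteq> 0" "e (- q) \<noteq> 0" "e p \<noteq> 0" "e (- p) \<noteq> 0"
    using norm_q norm_p by (auto intro!: e_nonzero)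
  have p2: "q\<^sup>2 = p" by (simp add: power2_eq_square qq)
  have "p / q = q" using q_nz by (simp flip: qq)
  hence 1: "theta_J 1 2 q = e q * e q * e p"
    by (simp add: theta_J_def theta_j_def p2)
  have 2: "theta_J_bar 0 1 q = 2 * e (- p) * e (- q) * (e (- q) * e (- p)) * (e q * e p)"
    by (simp add: theta_J_bar_def theta_j_def qpoch_inf_even_odd e_minus_1 qq)
  show ?thesis
    unfolding 1 2 using nz by (simp add: power2_eq_square power3_eq_cube mult_ac)
qed

text \<open>The integers are split by sign: nonnegative indices contribute \<open>S3_one q\<close>,
  negative ones twice the sum of \<open>cterm\<close>, and \<open>has_sum_bterm\<close> gives the
  total.\<close>

theorem S3_one_decomposition:
  "summable cterm"
  "S3_one q - (theta_J 1 2 q)\<^sup>2 / theta_J_bar 0 1 q = - 2 * (\<Sum>n. cterm n) - 2 * (e (- p))\<^sup>2 / e q * fine_sum"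
proof -
  define T where "T = - 2 * (e (- p))\<^sup>2 / e q * fine_sum"
  have summ: "bterm summable_on X" for X
    by (rule summable_on_subset_banach[OF has_sum_imp_summable[OF has_sum_bterm] subset_UNIV])
  obtain S where S: "(bterm has_sum S) (range int)"
    using summ unfolding summable_on_def by blast
  obtain C where C: "(bterm has_sum C) (range (\<lambda>n. - int n - 1))"
    using summ unfolding summable_on_def by blast
  have disj: "range int \<inter> range (\<lambda>n. - int n - 1) = {}" by auto
  have un: "range int \<union> range (\<lambda>n. - int n - 1) = UNIV"
  proof -
    have "m \<in> range int \<union> range (\<lambda>n. - int n - 1)" for m
    proof (cases "m \<ge> 0")
      case False
      hence "m = - int (nat (- m - 1)) - 1" by simp
      thus ?thesis by blast
    next
      case True
      hence "m = int (nat m)" by simp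
      thus ?thesis by blast
    qed
    thus ?thesis by blast
  qed
  have "(bterm has_sum (S + C)) UNIV"
    using has_sum_Un_disjoint[OF S C disj] unfolding un .
  hence SC: "S + C = (theta_J 1 2 q)\<^sup>2 / theta_J_bar 0 1 q - 2 * (e (- p))\<^sup>2 / e q * fine_sum"
    unfolding theta_quotient by (rule has_sum_unique[OF _ has_sum_bterm])
  have "((\<lambda>n. bterm (int n)) has_sum S) UNIV"
    using S by (subst (asm) has_sum_reindex) (auto simp: o_def)
  hence "(\<lambda>n. bterm (int n)) sums S" by (rule has_sum_imp_sums)
  moreover have "q\<^sup>2 = p" by (simp add: power2_eq_square qq)
  ultimately have S': "S3_one q = S"
    unfolding bterm_nat S3_one_def by (simp add: sums_iff)
  have "((\<lambda>n. bterm (- int n - 1)) has_sum C) UNIV"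
    using C by (subst (asm) has_sum_reindex) (auto simp: o_def inj_on_def)
  hence "(\<lambda>n. bterm (- int n - 1)) sums C" by (rule has_sum_imp_sums)
  hence "(\<lambda>n. 2 * cterm n / 2) sums (C / 2)"
    unfolding bterm_neg by (rule sums_divide)
  hence C': "cterm sums (C / 2)" by simp
  show "summable cterm" using C' by (rule sums_summable)
  show "S3_one q - (theta_J 1 2 q)\<^sup>2 / theta_J_bar 0 1 q = - 2 * (\<Sum>n. cterm n) - 2 * (e (- p))\<^sup>2 / e q * fine_sum"
    using SC C' unfolding S' by (simp add: sums_iff algebra_simps)
qed

end

section \<open>Products over roots of unity\<close>

text \<open>As polynomials in y both sides have degree at most N and agree at N + 1 points: 0 and
  the N distinct powers of 1/\<omega>.\<close>

lemma prod_one_minus_roots_of_unity: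
  fixes \<omega> y :: complex
  assumes "primitive_root_of_unity N \<omega>"
  shows "(\<Prod>s<N. 1 - y * \<omega> ^ s) = 1 - y ^ N"
proof -
  have N: "N > 0" "\<omega> ^ N = 1" and prim: "\<And>m. 0 < m \<Longrightarrow> m < N \<Longrightarrow> \<omega> ^ m \<noteq> 1"
    using assms by (auto simp: primitive_root_of_unity_def)
  have w0: "\<omega> \<noteq> 0" using N by (metis power_eq_0_iff zero_neq_one zero_power)
  have inj: "inj_on (\<lambda>s. inverse \<omega> ^ s) {..<N}"
  proof (rule linorder_inj_onI')
    fix i j assume "i \<in> {..<N}" "j \<in> {..<N}" "i < j"
    hence "\<omega> ^ (j - i) \<noteq> 1" by (intro prim) auto
    moreover have "\<omega> ^ j = \<omega> ^ i * \<omega> ^ (j - i)"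
      using \<open>i < j\<close> by (simp flip: power_add)
    ultimately show "inverse \<omega> ^ i \<noteq> inverse \<omega> ^ j"
      using w0 by (auto simp: power_inverse)
  qed
  define A where "A = insert 0 ((\<lambda>s. inverse \<omega> ^ s) ` {..<N})"
  have "card A = Suc N"
    unfolding A_def using w0 by (subst card_insert_disjoint) (auto simp: card_image[OF inj])
  define P where "P = (\<Prod>s<N. [:1, - (\<omega> ^ s):])"
  define Q :: "complex poly" where "Q = 1 - monom 1 N"
  have poly_P: "poly P z = (\<Prod>s<N. 1 - z * \<omega> ^ s)" for z
    by (simp add: P_def poly_prod)
  have "P = Q"
  proof (rule poly_eqI_degree)
    fix z assume "z \<in> A"
    then consider "z = 0" | s where "s < N" "z = inverse \<omega> ^ s" by (auto simp: A_def)
    thus "poly P z = poly Q z"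
    proof cases
      case 1
      thus ?thesis using N by (simp add: poly_P Q_def poly_monom power_0_left)
    next
      case 2
      have "1 - z * \<omega> ^ s = 0" using 2 w0 by (simp flip: power_mult_distrib)
      hence "poly P z = 0" using 2 unfolding poly_P by (intro prod_zero) auto
      moreover have "z ^ N = 1"
        using N by (simp add: 2 power_inverse power_commutes flip: power_mult) (simp add: mult.commute[of s] power_mult)
      ultimately show ?thesis by (simp add: Q_def poly_monom)
    qed
  next
    have "degree P \<le> (\<Sum>s<N. degree [:1, - (\<omega> ^ s):])"
      unfolding P_def by (rule degree_prod_sum_le[unfolded o_def]) auto
    also have "\<dots> \<le> (\<Sum>s<N. 1)" by (intro sum_mono) auto
    finally show "card A > degree P" using \<open>card A = Suc N\<close> by simp
    have "degree Q \<le> N" unfolding Q_def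
      by (intro degree_diff_le) (auto simp: degree_monom_le)
    thus "card A > degree Q" using \<open>card A = Suc N\<close> by simp
  qed
  thus ?thesis using poly_P[of y] by (simp add: Q_def poly_monom)
qed

text \<open>Models the q-products at q = r \<zeta>: \<omega> is the square of \<zeta>, u the
  unimodular part of the first argument, and the x i are decreasing powers of r. With constant
  weights x, a block of N consecutive factors would multiply to 1 - x^N u^N.\<close>

locale root_of_unity_factors =
  fixes \<omega> u :: complex and N :: nat and x :: "nat \<Rightarrow> real"
  assumes prim: "primitive_root_of_unity N \<omega>" and norm_u: "norm u = 1"
    and x_nonneg: "\<And>i. x i \<ge> 0" and x_le_1: "\<And>i. x i \<le> 1"
    and x_antimono: "\<And>i j. i \<le> j \<Longrightarrow> x j \<le> x i"
begin

lemma N_pos: "N > 0" and \<omega>_power_N: "\<omega> ^ N = 1"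
  using prim by (auto simp: primitive_root_of_unity_def)

lemma norm_\<omega>: "norm \<omega> = 1"
proof -
  have "norm \<omega> ^ N = 1" using \<omega>_power_N by (metis norm_one norm_power)
  thus ?thesis using N_pos power_eq_iff_eq_base[of N "norm \<omega>" 1] by simp
qed

definition v :: "nat \<Rightarrow> complex" where "v i = u * \<omega> ^ i"
definition f :: "nat \<Rightarrow> complex" where "f i = 1 - of_real (x i) * v i"

lemma norm_v: "norm (v i) = 1"
  by (simp add: v_def norm_mult norm_power norm_u norm_\<omega>)

lemma norm_one_minus_le: "t \<ge> 0 \<Longrightarrow> t \<le> 1 \<Longrightarrow> norm (1 - of_real t * v i) \<le> 2"
  using norm_triangle_ineq4[of 1 "of_real t * v i"] by (simp add: norm_mult norm_v)

lemma norm_f_le: "norm (f i) \<le> 2"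
  unfolding f_def by (intro norm_one_minus_le x_nonneg x_le_1)

lemma prod_v: "(\<Prod>s<N. 1 - of_real t * v (i + s)) = 1 - of_real t ^ N * u ^ N"
proof -
  have "(\<Prod>s<N. 1 - of_real t * v (i + s)) = (\<Prod>s<N. 1 - (of_real t * v i) * \<omega> ^ s)"
    by (simp add: v_def power_add mult_ac)
  also have "\<dots> = 1 - (of_real t * v i) ^ N"
    by (rule prod_one_minus_roots_of_unity[OF prim])
  also have "(\<omega> ^ i) ^ N = 1"
    using \<omega>_power_N by (metis mult.commute power_mult power_one)
  hence "(of_real t * v i) ^ N = of_real t ^ N * u ^ N"
    by (simp add: v_def power_mult_distrib)
  finally show ?thesis .
qed

definition K :: real where "K = 2 ^ N * real N"

text \<open>All weights in the block are replaced by the first one. Halving the factors makes their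
  norms at most 1, so the difference of products is at most the sum of N differences; undoing the
  halving costs 2^N, whence the constant \<open>K\<close>.\<close>

lemma block_diff:
  "norm ((\<Prod>s<N. f (i + s)) - (1 - of_real (x i) ^ N * u ^ N)) \<le> K * (x i - x (i + N))"
proof -
  define F where "F = (\<lambda>s. f (i + s) / 2)"
  define G where "G = (\<lambda>s. (1 - of_real (x i) * v (i + s)) / 2)"
  have "norm ((\<Prod>s<N. F s) - (\<Prod>s<N. G s)) \<le> (\<Sum>s<N. norm (F s - G s))"
  proof (rule norm_prod_diff)
    show "norm (F s) \<le> 1" for s using norm_f_le[of "i + s"] by (simp add: F_def norm_divide)
    show "norm (G s) \<le> 1" for s
      using norm_one_minus_le[OF x_nonneg x_le_1, of i "i + s"] by (simp add: G_def norm_divide)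
  qed
  also have "\<dots> \<le> (\<Sum>s<N. x i - x (i + N))"
  proof (rule sum_mono)
    fix s assume "s \<in> {..<N}"
    have "F s - G s = of_real (x i - x (i + s)) * v (i + s) / 2"
      by (simp add: F_def G_def f_def field_simps)
    hence "norm (F s - G s) = norm (of_real (x i - x (i + s)) * v (i + s) / 2)"
      by (simp only:)
    also have "\<dots> = (x i - x (i + s)) / 2"
      using x_antimono[of i "i + s"] by (simp add: norm_mult norm_divide norm_v del: of_real_diff)
    also have "\<dots> \<le> x i - x (i + N)"
      using x_antimono[of i "i + s"] x_antimono[of "i + s" "i + N"] \<open>s \<in> {..<N}\<close> by simp
    finally show "norm (F s - G s) \<le> x i - x (i + N)" .
  qed
  finally have le: "norm ((\<Prod>s<N. F s) - (\<Prod>s<N. G s)) \<le> real N * (x i - x (i + N))" by simp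
  have "(\<Prod>s<N. f (i + s)) - (1 - of_real (x i) ^ N * u ^ N) = 2 ^ N * ((\<Prod>s<N. F s) - (\<Prod>s<N. G s))"
    by (simp add: F_def G_def prod_dividef prod_v flip: diff_divide_distrib)
  hence "norm ((\<Prod>s<N. f (i + s)) - (1 - of_real (x i) ^ N * u ^ N)) = 2 ^ N * norm ((\<Prod>s<N. F s) - (\<Prod>s<N. G s))"
    by (simp add: norm_mult norm_power)
  also have "\<dots> \<le> 2 ^ N * (real N * (x i - x (i + N)))"
    by (intro mult_left_mono le) auto
  finally show ?thesis by (simp add: K_def mult_ac)
qed

lemma prod_split: "(\<Prod>i<m + n. f i) = (\<Prod>i<m. f i) * (\<Prod>i<n. f (m + i))"
  by (induction n) (simp_all add: mult_ac)

lemma K_nonneg: "K \<ge> 0" by (simp add: K_def)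

lemma K_diff_le: "c \<ge> 0 \<Longrightarrow> c * K * (x 0 - x i) \<le> c * K"
  using mult_left_mono[of "x 0 - x i" 1 "c * K"] x_nonneg[of i] x_le_1[of 0] K_nonneg by simp

text \<open>The bounds \<open>K (x\<^sub>i - x\<^sub>i\<^sub>+\<^sub>N)\<close> for the individual blocks telescope.\<close>
lemma norm_prod_le:
  assumes "u ^ N = 1"
  shows "norm (\<Prod>i<n. f i) \<le> 2 ^ N * exp K"
proof -
  \<comment> \<open>The unperturbed block 1 - x^N lies in [0,1], so each block multiplies the norm
    by at most 1 + d \<le> exp d.\<close>
  have blocks: "norm (\<Prod>i<m * N. f i) \<le> exp (K * (x 0 - x (m * N)))" for m
  proof (induction m)
    case (Suc m)
    define d where "d = K * (x (m * N) - x (m * N + N))"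
    define B where "B = (\<Prod>s<N. f (m * N + s))"
    have "norm B \<le> norm (1 - of_real (x (m * N)) ^ N * u ^ N :: complex) + d"
      using block_diff[of "m * N"] norm_triangle_sub[of B "1 - of_real (x (m * N)) ^ N * u ^ N"]
      by (simp add: d_def B_def)
    also have "(1 - of_real (x (m * N)) ^ N * u ^ N :: complex) = of_real (1 - x (m * N) ^ N)"
      by (simp add: assms)
    also have "norm (of_real (1 - x (m * N) ^ N) :: complex) \<le> 1"
      using power_le_one[OF x_nonneg x_le_1, of "m * N" N] zero_le_power[OF x_nonneg, of "m * N" N]
      by (simp del: of_real_diff)
    also have "1 + d \<le> exp d" by (rule exp_ge_add_one_self)
    finally have "norm B \<le> exp d" by simp
    hence "norm (\<Prod>i<m * N. f i) * norm B \<le> exp (K * (x 0 - x (m * N))) * exp d"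
      by (intro mult_mono Suc) auto
    moreover have "(\<Prod>i<Suc m * N. f i) = (\<Prod>i<m * N. f i) * B"
      using prod_split[of "m * N" N] by (simp add: B_def add.commute)
    moreover have "exp (K * (x 0 - x (m * N))) * exp d = exp (K * (x 0 - x (Suc m * N)))"
      by (simp add: d_def algebra_simps flip: exp_add)
    ultimately show ?case by (simp add: norm_mult)
  qed simp
  \<comment> \<open>The incomplete last block has fewer than N factors, each of norm at most
    2.\<close>
  define m s where "m = n div N" and "s = n mod N"
  have n: "n = m * N + s" and s: "s < N" using N_pos by (simp_all add: m_def s_def)
  have "norm (\<Prod>i<s. f (m * N + i)) \<le> (\<Prod>i<s. 2)"
    unfolding prod_norm[symmetric] by (intro prod_mono) (auto intro: norm_f_le)
  also have "\<dots> \<le> (2 :: real) ^ N" using s by simp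
  finally have "norm (\<Prod>i<s. f (m * N + i)) \<le> 2 ^ N" .
  moreover have "norm (\<Prod>i<m * N. f i) \<le> exp K"
    using blocks[of m] K_diff_le[of 1 "m * N"] by (simp add: order_trans)
  ultimately have "norm (\<Prod>i<m * N. f i) * norm (\<Prod>i<s. f (m * N + i)) \<le> exp K * 2 ^ N"
    by (intro mult_mono) auto
  thus ?thesis unfolding n prod_split norm_mult by (simp add: mult.commute)
qed

text \<open>Over a full period the factors multiply to 1 + t^N, which is at least 1, and each of the
  other factors has norm at most 2.\<close>

lemma norm_factor_ge:
  assumes "u ^ N = - 1" "t \<ge> 0" "t \<le> 1"
  shows "norm (1 - of_real t * v i) \<ge> 1 / 2 ^ N"
proof -
  have "1 + t ^ N \<ge> 1" using assms by simp
  moreover have "norm (1 - of_real t ^ N * u ^ N :: complex) = 1 + t ^ N"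
  proof -
    have "(1 - of_real t ^ N * u ^ N :: complex) = of_real (1 + t ^ N)" by (simp add: assms(1))
    thus ?thesis using assms by (simp del: of_real_add)
  qed
  ultimately have "1 \<le> norm (\<Prod>s<N. 1 - of_real t * v (i + s))" unfolding prod_v by simp
  also have "\<dots> = norm (1 - of_real t * v i) * (\<Prod>s\<in>{1..<N}. norm (1 - of_real t * v (i + s)))"
  proof -
    have "{..<N} = insert 0 {1..<N}" using N_pos by auto
    thus ?thesis by (simp add: norm_mult flip: prod_norm)
  qed
  also have "(\<Prod>s\<in>{1..<N}. norm (1 - of_real t * v (i + s))) \<le> (\<Prod>s\<in>{1..<N}. 2)"
    by (intro prod_mono conjI norm_ge_zero norm_one_minus_le assms)
  also have "\<dots> \<le> (2 :: real) ^ N" by simp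
  finally have "1 \<le> norm (1 - of_real t * v i) * 2 ^ N" by (simp add: mult_left_mono)
  thus ?thesis by (simp add: field_simps)
qed

text \<open>Here the unperturbed block is 1 + x^N, so a block with error d has norm at least 1 - d.
  The errors telescope in the exponent, and \<open>norm_factor_ge\<close> handles the incomplete
  block.\<close>

lemma norm_prod_ge:
  assumes "u ^ N = - 1" and small: "\<And>i. K * (x i - x (i + N)) \<le> 1 / 2"
  shows "norm (\<Prod>i<n. f i) \<ge> exp (- 2 * K) * (1 / 2 ^ N) ^ N"
proof -
  have blocks: "norm (\<Prod>i<m * N. f i) \<ge> exp (- 2 * K * (x 0 - x (m * N)))" for m
  proof (induction m)
    case (Suc m)
    define d where "d = K * (x (m * N) - x (m * N + N))"
    define B where "B = (\<Prod>s<N. f (m * N + s))"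
    have d: "0 \<le> d" "d \<le> 1 / 2"
      using small[of "m * N"] x_antimono[of "m * N" "m * N + N"] K_nonneg by (simp_all add: d_def)
    \<comment> \<open>Uses (1 - d)(1 + 2d) = 1 + d(1 - 2d) \<ge> 1, which is where d \<le> 1/2
      enters.\<close>
    have "exp (- 2 * d) \<le> 1 - d"
    proof -
      have "1 \<le> (1 - d) * (1 + 2 * d)"
        using mult_nonneg_nonneg[of d "1 - 2 * d"] d by (simp add: algebra_simps)
      also have "\<dots> \<le> (1 - d) * exp (2 * d)"
        using d by (intro mult_left_mono exp_ge_add_one_self) auto
      finally show ?thesis by (simp add: exp_minus field_simps)
    qed
    also have "1 - d \<le> norm (1 - of_real (x (m * N)) ^ N * u ^ N :: complex) - d"
    proof -
      have "(1 - of_real (x (m * N)) ^ N * u ^ N :: complex) = of_real (1 + x (m * N) ^ N)"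
        by (simp add: assms(1))
      thus ?thesis using zero_le_power[OF x_nonneg, of "m * N" N] by (simp del: of_real_add)
    qed
    also have "\<dots> \<le> norm B"
      using block_diff[of "m * N"] norm_triangle_sub[of "1 - of_real (x (m * N)) ^ N * u ^ N" B]
      by (simp add: d_def B_def norm_minus_commute)
    finally have "exp (- 2 * K * (x 0 - x (m * N))) * exp (- 2 * d) \<le> norm (\<Prod>i<m * N. f i) * norm B"
      by (intro mult_mono Suc) auto
    moreover have "(\<Prod>i<Suc m * N. f i) = (\<Prod>i<m * N. f i) * B"
      using prod_split[of "m * N" N] by (simp add: B_def add.commute)
    moreover have "exp (- 2 * K * (x 0 - x (m * N))) * exp (- 2 * d) = exp (- 2 * K * (x 0 - x (Suc m * N)))"
      by (simp add: d_def algebra_simps flip: exp_add)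
    ultimately show ?case by (simp add: norm_mult)
  qed simp
  define m s where "m = n div N" and "s = n mod N"
  have n: "n = m * N + s" and s: "s < N" using N_pos by (simp_all add: m_def s_def)
  have "(1 / 2 ^ N) ^ N \<le> (1 / 2 ^ N :: real) ^ s"
    using s by (intro power_decreasing) auto
  also have "\<dots> = (\<Prod>i<s. 1 / 2 ^ N)" by simp
  also have "\<dots> \<le> norm (\<Prod>i<s. f (m * N + i))"
    unfolding prod_norm[symmetric] f_def
    by (intro prod_mono conjI norm_factor_ge assms x_nonneg x_le_1) auto
  finally have "(1 / 2 ^ N) ^ N \<le> norm (\<Prod>i<s. f (m * N + i))" .
  moreover have "exp (- 2 * K) \<le> norm (\<Prod>i<m * N. f i)"
    using blocks[of m] K_diff_le[of 2 "m * N"] by (simp add: order_trans[rotated])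
  ultimately have "exp (- 2 * K) * (1 / 2 ^ N) ^ N \<le> norm (\<Prod>i<m * N. f i) * norm (\<Prod>i<s. f (m * N + i))"
    by (intro mult_mono) auto
  thus ?thesis unfolding n prod_split norm_mult .
qed

end

section \<open>The radial limit\<close>

lemma S3_one_eq:
  assumes "norm q < 1" "q \<noteq> 0"
  defines "p \<equiv> q\<^sup>2"
  shows "summable (\<lambda>n. q ^ (2 * n + 2) * (qpoch (- p) p n)\<^sup>2 / qpoch q p (n + 1))"
    and "S3_one q - (theta_J 1 2 q)\<^sup>2 / theta_J_bar 0 1 q =
      - 2 * (\<Sum>n. q ^ (2 * n + 2) * (qpoch (- p) p n)\<^sup>2 / qpoch q p (n + 1)) -
        2 * (qpoch_inf (- p) p)\<^sup>2 / qpoch_inf q p * (\<Sum>n. (- q) ^ Suc n / qpoch (- q) p (Suc n))"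
proof -
  interpret q_square_base q p
    by unfold_locales (use assms in \<open>auto simp: power2_eq_square\<close>)
  show "summable (\<lambda>n. q ^ (2 * n + 2) * (qpoch (- p) p n)\<^sup>2 / qpoch q p (n + 1))"
    using S3_one_decomposition(1) unfolding cterm_def[abs_def] .
  show "S3_one q - (theta_J 1 2 q)\<^sup>2 / theta_J_bar 0 1 q =
      - 2 * (\<Sum>n. q ^ (2 * n + 2) * (qpoch (- p) p n)\<^sup>2 / qpoch q p (n + 1)) -
        2 * (qpoch_inf (- p) p)\<^sup>2 / qpoch_inf q p * (\<Sum>n. (- q) ^ Suc n / qpoch (- q) p (Suc n))"
    using S3_one_decomposition(2) unfolding cterm_def fine_sum_def .
qed

lemma norm_suminf_geometric_le:
  fixes g :: "nat \<Rightarrow> complex"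
  assumes "\<And>n. norm (g n) \<le> C * r ^ n" "0 \<le> r" "r < 1"
  shows "norm (suminf g) \<le> C / (1 - r)"
proof -
  have "(\<lambda>n. C * r ^ n) sums (C * (1 / (1 - r)))"
    using assms by (intro sums_mult geometric_sums) auto
  hence S: "summable (\<lambda>n. C * r ^ n)" "(\<Sum>n. C * r ^ n) = C / (1 - r)"
    by (simp_all only: sums_iff times_divide_eq_right mult_1_right)
  show ?thesis using norm_suminf_le[OF assms(1) S(1)] unfolding S(2) .
qed

section \<open>Uniform estimates on the radius towards \<zeta>\<close>

locale radial_approach =
  fixes k :: nat and \<zeta> :: complex
  assumes k: "k \<ge> 1" and prim: "primitive_root_of_unity (4 * k) \<zeta>"
begin

text \<open>N is the order of the square of \<zeta>, hence the block length, and also the exponent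
  with \<zeta>^N = -1.\<close>

abbreviation N :: nat where "N \<equiv> 2 * k"

lemma zeta_power: "\<zeta> ^ (4 * k) = 1" and zeta_power_neq: "0 < m \<Longrightarrow> m < 4 * k \<Longrightarrow> \<zeta> ^ m \<noteq> 1"
  using prim by (auto simp: primitive_root_of_unity_def)

lemma norm_zeta: "norm \<zeta> = 1"
proof -
  have "norm \<zeta> ^ (4 * k) = 1" using zeta_power by (metis norm_one norm_power)
  thus ?thesis using k power_eq_iff_eq_base[of "4 * k" "norm \<zeta>" 1] by simp
qed

lemma zeta_power_N: "\<zeta> ^ N = - 1"
proof -
  have "(\<zeta> ^ N)\<^sup>2 = 1" using zeta_power by (simp flip: power_mult add: mult.commute)
  moreover have "\<zeta> ^ N \<noteq> 1" using k by (intro zeta_power_neq) auto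
  ultimately show ?thesis by (simp add: power2_eq_1_iff)
qed

lemma prim_zeta_sq: "primitive_root_of_unity N (\<zeta>\<^sup>2)"
  unfolding primitive_root_of_unity_def
proof (intro conjI allI impI)
  show "(\<zeta>\<^sup>2) ^ N = 1" using zeta_power by (simp flip: power_mult)
  fix m assume "0 < m \<and> m < N"
  hence "\<zeta> ^ (2 * m) \<noteq> 1" by (intro zeta_power_neq) auto
  thus "(\<zeta>\<^sup>2) ^ m \<noteq> 1" by (simp flip: power_mult)
qed (use k in auto)

text \<open>The lower bound of \<open>norm_prod_ge\<close> with \<open>K\<close> written
  out.\<close>

definition L :: real where "L = exp (- 2 * (2 ^ N * real N)) * (1 / 2 ^ N) ^ N"
text \<open>Three contributions: 2^k bounds the first k - 1 factors, N comes from 1 - r^N \<le> N (1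
  - r), and the rest is the bound of \<open>norm_prod_le\<close>.\<close>

definition W :: real where "W = 2 ^ k * (2 ^ N * exp (2 ^ N * real N)) * real N"

lemma L_pos: "L > 0" by (simp add: L_def)

text \<open>The condition \<open>small\<close> keeps every block error at most 1/2, as
  \<open>norm_prod_ge\<close> requires; it holds for r near 1.\<close>

context
  fixes r :: real and q p :: complex
  assumes r: "0 < r" "r < 1" and small: "2 ^ N * real N * (1 - r ^ (2 * N)) \<le> 1 / 2"
    and q: "q = of_real r * \<zeta>" and p: "p = q\<^sup>2"
begin

lemma norm_q: "norm q = r"
  using r by (simp add: q norm_mult norm_zeta)

lemma p_power: "p ^ i = of_real (r ^ (2 * i)) * (\<zeta>\<^sup>2) ^ i"
  by (simp add: p q power_mult_distrib power_mult)

text \<open>Since N is even, both signs of y satisfy y^N = -1, the case of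
  \<open>norm_prod_ge\<close>.\<close>

lemma norm_qpoch_ge:
  assumes "y = \<zeta> \<or> y = - \<zeta>"
  shows "norm (qpoch (of_real r * y) p n) \<ge> L"
proof -
  interpret root_of_unity_factors "\<zeta>\<^sup>2" y N "\<lambda>i. r ^ (2 * i + 1)"
  proof
    show "norm y = 1" using assms norm_zeta by auto
    show "0 \<le> r ^ (2 * i + 1)" "r ^ (2 * i + 1) \<le> 1" for i
      using r power_le_one[of r "2 * i + 1"] by auto
    show "r ^ (2 * j + 1) \<le> r ^ (2 * i + 1)" if "i \<le> j" for i j
      using that r by (intro power_decreasing) auto
  qed (rule prim_zeta_sq)
  have "K * (r ^ (2 * i + 1) - r ^ (2 * (i + N) + 1)) \<le> 1 / 2" for i
  proof -
    have "r ^ (2 * i + 1) - r ^ (2 * (i + N) + 1) = r ^ (2 * i + 1) * (1 - r ^ (2 * N))"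
      by (simp add: algebra_simps flip: power_add)
    also have "\<dots> \<le> 1 * (1 - r ^ (2 * N))"
      using r by (intro mult_right_mono power_le_one) (auto intro: power_le_one)
    finally have "K * (r ^ (2 * i + 1) - r ^ (2 * (i + N) + 1)) \<le> K * (1 * (1 - r ^ (2 * N)))"
      by (intro mult_left_mono K_nonneg)
    also have "\<dots> \<le> 1 / 2" using small by (simp add: K_def)
    finally show ?thesis .
  qed
  moreover have "y ^ N = - 1" using assms zeta_power_N by auto
  ultimately have "norm (\<Prod>i<n. f i) \<ge> L"
    using norm_prod_ge[of n] by (simp add: K_def L_def)
  moreover have "(\<Prod>i<n. f i) = qpoch (of_real r * y) p n"
    unfolding qpoch_def f_def v_def by (intro prod.cong refl) (simp add: p_power mult_ac)
  ultimately show ?thesis by simp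
qed

lemma norm_qpoch_q_ge: "norm (qpoch q p n) \<ge> L" and norm_qpoch_minus_q_ge: "norm (qpoch (- q) p n) \<ge> L"
  using norm_qpoch_ge[of \<zeta> n] norm_qpoch_ge[of "- \<zeta>" n] by (simp_all add: q)

text \<open>For \<open>n \<ge> k\<close> the product contains the factor \<open>1 + q\<^sup>2\<^sup>k = 1 - r\<^sup>2\<^sup>k\<close>.\<close>
lemma norm_qpoch_minus_p_le:
  assumes "n \<ge> k"
  shows "norm (qpoch (- p) p n) \<le> W * (1 - r)"
proof -
  \<comment> \<open>After the factor 1 + p^k is split off, the remaining product starts at 1 +
    p^(k+1). Its unimodular part y satisfies y^N = 1, so \<open>norm_prod_le\<close>
    applies.\<close>
  define y where "y = - ((\<zeta>\<^sup>2) ^ (k + 1))"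
  interpret root_of_unity_factors "\<zeta>\<^sup>2" y N "\<lambda>i. r ^ (2 * (k + 1 + i))"
  proof
    show "norm y = 1" by (simp add: y_def norm_mult norm_power norm_zeta)
    show "0 \<le> r ^ (2 * (k + 1 + i))" "r ^ (2 * (k + 1 + i)) \<le> 1" for i
      using r power_le_one[of r "2 * (k + 1 + i)"] by auto
    show "r ^ (2 * (k + 1 + j)) \<le> r ^ (2 * (k + 1 + i))" if "i \<le> j" for i j
      using that r by (intro power_decreasing) auto
  qed (rule prim_zeta_sq)
  have "y ^ N = ((\<zeta>\<^sup>2) ^ (k + 1)) ^ N"
    unfolding y_def by (rule power_minus_even) simp
  also have "\<dots> = ((\<zeta>\<^sup>2) ^ N) ^ (k + 1)"
    by (metis mult.commute power_mult)
  finally have "y ^ N = ((\<zeta>\<^sup>2) ^ N) ^ (k + 1)" .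
  hence yN: "y ^ N = 1"
    using \<omega>_power_N by simp
  have "qpoch (- p) p n = qpoch (- p) p k * qpoch (- p * p ^ k) p (n - k)"
    using qpoch_add[of "- p" p k "n - k"] assms by simp
  moreover have "qpoch (- p) p k = qpoch (- p) p (k - 1) * (1 + p ^ k)"
    using k qpoch_Suc[of "- p" p "k - 1"] by (cases k) auto
  ultimately have "qpoch (- p) p n = qpoch (- p) p (k - 1) * (1 + p ^ k) * qpoch (- p * p ^ k) p (n - k)"
    by simp
  moreover have "qpoch (- p * p ^ k) p (n - k) = (\<Prod>i<n - k. f i)"
  proof -
    have "1 - - p * p ^ k * p ^ i = f i" for i
    proof -
      have "1 - - p * p ^ k * p ^ i = 1 + p ^ (k + 1 + i)" by (simp add: power_add)
      also have "\<dots> = f i"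
        unfolding p_power unfolding f_def v_def unfolding y_def by (simp add: power_add mult_ac)
      finally show ?thesis .
    qed
    thus ?thesis unfolding qpoch_def by simp
  qed
  moreover have "1 + p ^ k = of_real (1 - r ^ N)"
    unfolding p_power using zeta_power_N by (simp flip: power_mult)
  ultimately have eq: "norm (qpoch (- p) p n) =
      norm (qpoch (- p) p (k - 1)) * norm (of_real (1 - r ^ N) :: complex) * norm (\<Prod>i<n - k. f i)"
    by (simp only: norm_mult)
  have "norm (qpoch (- p) p (k - 1)) \<le> (\<Prod>i<k - 1. 2)"
    unfolding qpoch_def prod_norm[symmetric]
  proof (intro prod_mono conjI norm_ge_zero)
    fix i
    have "norm (p * p ^ i) \<le> 1"
      using r by (simp add: p norm_mult norm_power norm_q mult_le_one power_le_one)
    thus "norm (1 - - p * p ^ i) \<le> 2"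
      using norm_triangle_ineq[of 1 "p * p ^ i"] by simp
  qed
  also have "\<dots> \<le> (2::real) ^ k" by simp
  finally have 1: "norm (qpoch (- p) p (k - 1)) \<le> 2 ^ k" .
  have "1 + real N * (r - 1) \<le> r ^ N"
    using Bernoulli_inequality[of "r - 1" N] r by simp
  hence "norm (of_real (1 - r ^ N) :: complex) \<le> real N * (1 - r)"
    using r power_le_one[of r N] by (simp add: algebra_simps del: of_real_diff)
  hence "norm (qpoch (- p) p n) \<le> 2 ^ k * (real N * (1 - r)) * (2 ^ N * exp K)"
    unfolding eq using 1 norm_prod_le[OF yN] r by (intro mult_mono) auto
  thus ?thesis unfolding W_def K_def by (simp only: mult_ac)
qed

text \<open>The squared product supplies (1 - r)^2. Summing the geometric factor will cost only 1 /
  (1 - r).\<close>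

lemma term_tail_le:
  assumes "n \<ge> k"
  shows "norm (q ^ (2 * n + 2) * (qpoch (- p) p n)\<^sup>2 / qpoch q p (n + 1)) \<le> W\<^sup>2 / L * (1 - r)\<^sup>2 * r ^ n"
proof -
  have "r ^ (2 * n + 2) \<le> r ^ n" using r by (intro power_decreasing) auto
  moreover have "(norm (qpoch (- p) p n))\<^sup>2 \<le> (W * (1 - r))\<^sup>2"
    by (intro power_mono norm_qpoch_minus_p_le assms) auto
  ultimately have "r ^ (2 * n + 2) * (norm (qpoch (- p) p n))\<^sup>2 / norm (qpoch q p (n + 1))
      \<le> r ^ n * (W * (1 - r))\<^sup>2 / L"
    using r L_pos norm_qpoch_q_ge[of "n + 1"] by (intro frac_le mult_mono) auto
  thus ?thesis by (simp add: norm_mult norm_divide norm_power norm_q power_mult_distrib mult_ac)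
qed

text \<open>Both error terms, the tail of the \<open>cterm\<close> series and the multiple of
  \<open>fine_sum\<close>, pair a squared small product with a series of size O(1 / (1 - r)),
  leaving O(1 - r).\<close>

lemma norm_difference_le:
  "norm (S3_one q - (theta_J 1 2 q)\<^sup>2 / theta_J_bar 0 1 q
      + 2 * (\<Sum>n<k. q ^ (2 * n + 2) * (qpoch (- p) p n)\<^sup>2 / qpoch q p (n + 1)))
    \<le> (2 * (W\<^sup>2 / L) + 2 * (W\<^sup>2 / L) / L) * (1 - r)"
proof -
  have q1: "norm q < 1" "q \<noteq> 0" using r norm_q by auto
  have p1: "norm p < 1" using q1 by (simp add: p norm_power power_less_one_iff)
  define c where "c = (\<lambda>n. q ^ (2 * n + 2) * (qpoch (- p) p n)\<^sup>2 / qpoch q p (n + 1))"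
  define M where "M = (\<Sum>n. (- q) ^ Suc n / qpoch (- q) p (Suc n))"
  define D where "D = 2 * (qpoch_inf (- p) p)\<^sup>2 / qpoch_inf q p * M"
  have summ: "summable c" unfolding c_def p by (rule S3_one_eq(1)[OF q1])
  have "S3_one q - (theta_J 1 2 q)\<^sup>2 / theta_J_bar 0 1 q = - 2 * (\<Sum>n. c n) - D"
    unfolding c_def D_def M_def p by (rule S3_one_eq(2)[OF q1])
  also have "(\<Sum>n. c n) = (\<Sum>n. c (n + k)) + (\<Sum>n<k. c n)"
    by (rule suminf_split_initial_segment[OF summ])
  finally have "S3_one q - (theta_J 1 2 q)\<^sup>2 / theta_J_bar 0 1 q + 2 * (\<Sum>n<k. c n) = - (2 * (\<Sum>n. c (n + k)) + D)"
    by (simp add: algebra_simps)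
  hence "norm (S3_one q - (theta_J 1 2 q)\<^sup>2 / theta_J_bar 0 1 q + 2 * (\<Sum>n<k. c n)) = norm (2 * (\<Sum>n. c (n + k)) + D)"
    by (simp only: norm_minus_cancel)
  also have "\<dots> \<le> 2 * norm (\<Sum>n. c (n + k)) + norm D"
    using norm_triangle_ineq[of "2 * (\<Sum>n. c (n + k))" D] by (simp add: norm_mult)
  finally have le: "norm (S3_one q - (theta_J 1 2 q)\<^sup>2 / theta_J_bar 0 1 q + 2 * (\<Sum>n<k. c n))
      \<le> 2 * norm (\<Sum>n. c (n + k)) + norm D" .
  have "norm (\<Sum>n. c (n + k)) \<le> W\<^sup>2 / L * (1 - r)\<^sup>2 / (1 - r)"
  proof (rule norm_suminf_geometric_le)
    fix n
    have "norm (c (n + k)) \<le> W\<^sup>2 / L * (1 - r)\<^sup>2 * r ^ (n + k)"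
      unfolding c_def by (rule term_tail_le) simp
    also have "\<dots> \<le> W\<^sup>2 / L * (1 - r)\<^sup>2 * r ^ n"
      using r L_pos by (intro mult_left_mono power_decreasing) auto
    finally show "norm (c (n + k)) \<le> W\<^sup>2 / L * (1 - r)\<^sup>2 * r ^ n" .
  qed (use r in auto)
  hence tail: "norm (\<Sum>n. c (n + k)) \<le> W\<^sup>2 / L * (1 - r)"
    using r by (simp add: power2_eq_square)
  \<comment> \<open>The bounds are uniform in the number of factors and so pass to the infinite
    products.\<close>
  have num: "norm (qpoch_inf (- p) p) \<le> W * (1 - r)"
  proof (rule tendsto_upperbound[OF tendsto_norm[OF qpoch_tendsto_qpoch_inf[OF p1]]])
    show "\<forall>\<^sub>F n in sequentially. norm (qpoch (- p) p n) \<le> W * (1 - r)"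
      using eventually_ge_at_top[of k] by eventually_elim (rule norm_qpoch_minus_p_le)
  qed auto
  have den: "norm (qpoch_inf q p) \<ge> L"
    by (rule tendsto_lowerbound[OF tendsto_norm[OF qpoch_tendsto_qpoch_inf[OF p1]]])
       (auto intro!: always_eventually norm_qpoch_q_ge)
  have M: "norm M \<le> 1 / L / (1 - r)"
    unfolding M_def
  proof (rule norm_suminf_geometric_le)
    fix n
    have "r ^ Suc n / norm (qpoch (- q) p (Suc n)) \<le> r ^ n / L"
      using r L_pos by (intro frac_le norm_qpoch_minus_q_ge power_decreasing) auto
    thus "norm ((- q) ^ Suc n / qpoch (- q) p (Suc n)) \<le> 1 / L * r ^ n"
      by (simp add: norm_divide norm_mult norm_power norm_q)
  qed (use r in auto)
  have "norm D = 2 * (norm (qpoch_inf (- p) p))\<^sup>2 / norm (qpoch_inf q p) * norm M"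
    by (simp add: D_def norm_mult norm_divide norm_power)
  also have "\<dots> \<le> 2 * (W * (1 - r))\<^sup>2 / L * (1 / L / (1 - r))"
    using r L_pos by (intro mult_mono frac_le M den power_mono num) auto
  also have "\<dots> = 2 * (W\<^sup>2 / L) / L * (1 - r)"
    using r by (simp add: power2_eq_square)
  finally have "2 * norm (\<Sum>n. c (n + k)) + norm D \<le> 2 * (W\<^sup>2 / L * (1 - r)) + 2 * (W\<^sup>2 / L) / L * (1 - r)"
    using tail by (intro add_mono mult_left_mono) auto
  with le show ?thesis unfolding c_def by (simp add: algebra_simps)
qed

end

text \<open>A vanishing factor would make an odd power of \<zeta> equal to 1, but the N-th power of
  any odd power of \<zeta> is -1.\<close>

lemma qpoch_zeta_nonzero: "qpoch \<zeta> (\<zeta>\<^sup>2) n \<noteq> 0"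
proof (rule qpoch_nonzero)
  fix i
  have "\<zeta> * (\<zeta>\<^sup>2) ^ i = \<zeta> ^ (2 * i + 1)" by (simp add: power_mult)
  moreover have "\<zeta> ^ (2 * i + 1) \<noteq> 1"
  proof
    assume h: "\<zeta> ^ (2 * i + 1) = 1"
    have "(\<zeta> ^ N) ^ (2 * i + 1) = (\<zeta> ^ (2 * i + 1)) ^ N"
      by (simp only: mult.commute flip: power_mult)
    thus False unfolding h zeta_power_N by simp
  qed
  ultimately show "\<zeta> * (\<zeta>\<^sup>2) ^ i \<noteq> 1" by (simp only: not_False_eq_True)
qed

text \<open>The truncated sum S is a rational function of q, continuous at \<zeta> because its
  denominators do not vanish there. By \<open>norm_difference_le\<close>, G + 2 S tends to 0 along
  the radius.\<close>

lemma radial_limit: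
  "((\<lambda>r::real. let q = of_real r * \<zeta> in S3_one q - (theta_J 1 2 q)\<^sup>2 / theta_J_bar 0 1 q)
    \<longlongrightarrow> - 2 * (\<Sum>n<k. \<zeta> ^ (2 * n + 2) * (qpoch (- (\<zeta>\<^sup>2)) (\<zeta>\<^sup>2) n)\<^sup>2 / qpoch \<zeta> (\<zeta>\<^sup>2) (n + 1))) (at_left 1)"
proof -
  define G where "G = (\<lambda>q. S3_one q - (theta_J 1 2 q)\<^sup>2 / theta_J_bar 0 1 q)"
  define S where "S = (\<lambda>q. \<Sum>n<k. q ^ (2 * n + 2) * (qpoch (- (q\<^sup>2)) (q\<^sup>2) n)\<^sup>2 / qpoch q (q\<^sup>2) (n + 1))"
  define C where "C = 2 * (W\<^sup>2 / L) + 2 * (W\<^sup>2 / L) / L"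
  have lim_r: "((\<lambda>r::real. r) \<longlongrightarrow> 1) (at_left 1)" by (rule tendsto_ident_at)
  have lim_q: "((\<lambda>r::real. of_real r * \<zeta>) \<longlongrightarrow> \<zeta>) (at_left 1)"
    using tendsto_mult[OF tendsto_of_real[OF lim_r] tendsto_const, of \<zeta>] by simp
  have "((\<lambda>r. S (of_real r * \<zeta>)) \<longlongrightarrow> S \<zeta>) (at_left 1)"
    unfolding S_def using qpoch_zeta_nonzero
    by (intro tendsto_sum tendsto_divide tendsto_mult tendsto_power lim_q)
       (auto simp: qpoch_def intro!: tendsto_intros lim_q)
  moreover have "((\<lambda>r. G (of_real r * \<zeta>) + 2 * S (of_real r * \<zeta>)) \<longlongrightarrow> 0) (at_left 1)"
  proof (rule Lim_null_comparison)
    have "((\<lambda>r. 2 ^ N * real N * (1 - r ^ (2 * N))) \<longlongrightarrow> 2 ^ N * real N * (1 - 1 ^ (2 * N))) (at_left 1)"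
      by (intro tendsto_intros)
    hence "\<forall>\<^sub>F r in at_left 1. 2 ^ N * real N * (1 - r ^ (2 * N)) < 1 / 2"
      by (rule order_tendstoD) simp
    moreover have "\<forall>\<^sub>F r in at_left (1::real). 0 < r \<and> r < 1"
      using eventually_at_left_real[of 0 1] by simp
    ultimately show "\<forall>\<^sub>F r in at_left 1. norm (G (of_real r * \<zeta>) + 2 * S (of_real r * \<zeta>)) \<le> C * (1 - r)"
    proof eventually_elim
      case (elim r)
      thus ?case
        using norm_difference_le[of r "of_real r * \<zeta>" "(of_real r * \<zeta>)\<^sup>2"]
        unfolding G_def S_def C_def by simp
    qed
    show "((\<lambda>r. C * (1 - r)) \<longlongrightarrow> 0) (at_left 1)"
      using tendsto_mult[OF tendsto_const tendsto_diff[OF tendsto_const lim_r], of C 1] by simp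
  qed
  ultimately have "((\<lambda>r. (G (of_real r * \<zeta>) + 2 * S (of_real r * \<zeta>)) - 2 * S (of_real r * \<zeta>)) \<longlongrightarrow> 0 - 2 * S \<zeta>) (at_left 1)"
    by (intro tendsto_diff tendsto_mult tendsto_const)
  thus ?thesis by (simp add: G_def S_def Let_def)
qed

end

theorem theorem4p3:
  fixes k :: nat and \<zeta> :: complex
  assumes "k \<ge> 1"
    and "primitive_root_of_unity (4 * k) \<zeta>"
  shows "((\<lambda>r::real. let q = of_real r * \<zeta> in
             S3_one q - (theta_J 1 2 q)\<^sup>2 / theta_J_bar 0 1 q)
          \<longlongrightarrow> - 2 * (\<Sum>n<k. \<zeta> ^ (2 * n + 2) * (qpoch (- (\<zeta>\<^sup>2)) (\<zeta>\<^sup>2) n)\<^sup>2 /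
                              qpoch \<zeta> (\<zeta>\<^sup>2) (n + 1))) (at_left 1)"
proof -
  interpret radial_approach k \<zeta> by unfold_locales (fact assms)+
  show ?thesis by (rule radial_limit)
qed

end
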